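(* Let $(X,\tau_X)$ be a Polish space and $T:X\to X$ be $\tau_X$-continuous. Assume $X$ is endowed with a Hausdorff topology $\tau$ coarser than $\tau_X$ such that every point has a $\tau_X$-neighbourhood basis consisting of $\tau$-compact sets, and that $T$ is continuous with respect to $\tau$. Then the following are equivalent: (1) $T$ admits an invariant Borel probability measure with full support; (2) for each nonempty open set $V$ there is an ergodic measure $\mu_V$ for $T$ with $\mu_V(V)>0$; (3) $T$ is frequently recurrent.
   Context: $T$ is frequently recurrent if for every nonempty open $V\subset X$ there exists $x_V\in V$ such that $\{n\in\mathbb N: T^nx_V\in V\}$ has positive lower density (lower density $\liminf_N\frac1N\#(D\cap[1,N])$). Open sets and full support refer to $\tau_X$. *)

theory Defs
  imports "HOL-Analysis.Analysis" "HOL-Probability.Probability"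
begin

definition borel_prob :: "'a::topological_space measure \<Rightarrow> bool" where
  "borel_prob M \<longleftrightarrow> sets M = sets borel \<and> prob_space M"

definition invariant_measure :: "('a::topological_space \<Rightarrow> 'a) \<Rightarrow> 'a measure \<Rightarrow> bool" where
  "invariant_measure T M \<longleftrightarrow> borel_prob M \<and> T \<in> borel_measurable borel \<and>
     (\<forall>A \<in> sets borel. emeasure M (T -` A) = emeasure M A)"

definition full_support :: "'a::topological_space measure \<Rightarrow> bool" where
  "full_support M \<longleftrightarrow> (\<forall>V. open V \<and> V \<noteq> {} \<longrightarrow> emeasure M V > 0)"

definition ergodic_measure :: "('a::topological_space \<Rightarrow> 'a) \<Rightarrow> 'a measure \<Rightarrow> bool" where
  "ergodic_measure T M \<longleftrightarrow> invariant_measure T M \<and>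
     (\<forall>A \<in> sets borel. T -` A = A \<longrightarrow> measure M A = 0 \<or> measure M A = 1)"

definition lower_density :: "nat set \<Rightarrow> ereal" where
  "lower_density D = liminf (\<lambda>N. ereal (real (card (D \<inter> {1..N})) / real N))"

definition frequently_recurrent :: "('a::topological_space \<Rightarrow> 'a) \<Rightarrow> bool" where
  "frequently_recurrent T \<longleftrightarrow> (\<forall>V. open V \<and> V \<noteq> {} \<longrightarrow>
     (\<exists>x\<in>V. lower_density {n. (T ^^ n) x \<in> V} > 0))"

end

theory Submission
  imports Defs
begin

text \<open>
  The engine is a substitute for weak compactness. A net of invariant (or asymptotically invariant)
  probability measures has a pointwise limit \<open>m\<close> that is only finitely additive. Regularising \<open>m\<close> on
  \<open>\<tau>\<close>-compact sets by \<open>\<tau>\<close>-open sets gives a tight content, which extends to a Borel measure because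
  the \<open>\<tau>\<close>-compact sets generate the Borel sets. The extension dominates \<open>m\<close> on \<open>\<tau>\<close>-compact sets, so it
  does not vanish once \<open>m\<close> charges a compact set, and it is invariant because \<open>T\<close> maps
  \<open>\<tau>\<close>-compact sets to \<open>\<tau>\<close>-compact sets.

  Applied to the empirical measures of a frequently recurrent point, this gives (3) \<open>\<Longrightarrow>\<close> (1).
  Applied to a maximising sequence of a strictly convex functional
  \<open>M \<mapsto> \<Sum>n. w n * (M (C n))\<^sup>2\<close>, it shows that the maximum over invariant probability measures is
  attained; a maximiser is an extreme point, hence ergodic, and suitable weights make it charge a
  given set, which gives (1) \<open>\<Longrightarrow>\<close> (2). Finally (2) \<open>\<Longrightarrow>\<close> (3) follows from the maximal ergodic inequality.
\<close>

section \<open>Cluster points of bounded families\<close>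

text \<open>By Tychonoff the cube of functions into \<open>{a..b}\<close> is compact, so the
  sequence \<open>f\<close> has a cluster point \<open>m\<close>. The index type will be that of all
  sets, for which a pointwise convergent subsequence need not exist; a filter finer than
  \<open>sequentially\<close> takes its place.\<close>

lemma cluster_filter_pointwise:
  fixes f :: "nat \<Rightarrow> 'i \<Rightarrow> real"
  assumes "\<And>n i. f n i \<in> {a..b}"
  obtains G m where "G \<noteq> bot" "G \<le> sequentially" "\<And>i. ((\<lambda>n. f n i) \<longlongrightarrow> m i) G"
proof -
  let ?P = "PiE UNIV (\<lambda>i::'i. {a..b})"
  have "compact ?P"
    using compactin_PiE[of "\<lambda>i::'i. euclidean :: real topology" UNIV "\<lambda>i. {a..b}"]
    by (simp add: euclidean_product_topology)
  moreover have "filtermap f sequentially \<noteq> bot"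
    by (simp add: filtermap_bot_iff)
  moreover have "eventually (\<lambda>g. g \<in> ?P) (filtermap f sequentially)"
    using assms by (simp add: eventually_filtermap PiE_def extensional_def)
  ultimately obtain m where m: "inf (nhds m) (filtermap f sequentially) \<noteq> bot"
    unfolding compact_filter by blast
  \<comment> \<open>The coarsest filter below \<open>sequentially\<close> along which
    \<open>f\<close> tends to \<open>m\<close>. That it is not \<open>bot\<close> is exactly the
    cluster point property.\<close>
  define G where "G = inf sequentially (filtercomap f (nhds m))"
  have "G \<noteq> bot"
  proof
    assume "G = bot"
    then have "eventually (\<lambda>_. False) G" by simp
    then obtain P Q where P: "eventually P sequentially" and Q: "eventually Q (filtercomap f (nhds m))"
      and PQ: "\<And>n. P n \<Longrightarrow> Q n \<Longrightarrow> False"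
      unfolding G_def eventually_inf by blast
    from Q obtain R where R: "eventually R (nhds m)" "\<And>n. R (f n) \<Longrightarrow> Q n"
      unfolding eventually_filtercomap by blast
    have "eventually (\<lambda>g. \<not> R g) (filtermap f sequentially)"
      unfolding eventually_filtermap using P by eventually_elim (use R PQ in blast)
    then have "eventually (\<lambda>_. False) (inf (nhds m) (filtermap f sequentially))"
      unfolding eventually_inf using R(1) by blast
    with m show False by (simp add: trivial_limit_def)
  qed
  moreover have "G \<le> sequentially" by (simp add: G_def)
  moreover have "((\<lambda>n. f n i) \<longlongrightarrow> m i) G" for i
  proof -
    have "filterlim f (nhds m) G"
      unfolding G_def filterlim_iff_le_filtercomap by simp
    moreover have "((\<lambda>g. g i) \<longlongrightarrow> m i) (nhds m)"
    proof (rule topological_tendstoI)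
      fix S :: "real set" assume S: "open S" "m i \<in> S"
      have "continuous_on UNIV (\<lambda>g::'i \<Rightarrow> real. g i)"
        by (rule continuous_on_product_coordinates)
      then have "open ((\<lambda>g::'i \<Rightarrow> real. g i) -` S)"
        using S(1) by (rule open_vimage[rotated])
      then show "eventually (\<lambda>g. g i \<in> S) (nhds m)"
        unfolding eventually_nhds using S(2) by auto
    qed
    ultimately show ?thesis
      by (rule filterlim_compose[rotated])
  qed
  ultimately show ?thesis using that by blast
qed

section \<open>Measures from finitely additive set functions\<close>

locale finitely_additive_borel =
  fixes \<tau> :: "'a::topological_space topology" and m :: "'a set \<Rightarrow> real"
  assumes topspace_eq [simp]: "topspace \<tau> = UNIV"
    and Hausdorff: "Hausdorff_space \<tau>"
    and coarser: "\<And>U. openin \<tau> U \<Longrightarrow> open U"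
    and borel_generated: "sets borel = sigma_sets UNIV {C. compactin \<tau> C}"
    and m_nonneg: "\<And>A. A \<in> sets borel \<Longrightarrow> 0 \<le> m A"
    and m_Un: "\<And>A B. A \<in> sets borel \<Longrightarrow> B \<in> sets borel \<Longrightarrow> A \<inter> B = {} \<Longrightarrow> m (A \<union> B) = m A + m B"
begin

lemma openin_borel: "openin \<tau> U \<Longrightarrow> U \<in> sets borel"
  by (intro borel_open coarser)

lemma compactin_closedin: "compactin \<tau> C \<Longrightarrow> closedin \<tau> C"
  using Hausdorff by (rule compactin_imp_closedin)

lemma compactin_borel: "compactin \<tau> C \<Longrightarrow> C \<in> sets borel"
  unfolding borel_generated by auto

lemma compactin_Int_cl: "compactin \<tau> C \<Longrightarrow> compactin \<tau> D \<Longrightarrow> compactin \<tau> (C \<inter> D)"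
  by (intro compact_Int_closedin compactin_closedin)

lemma compactin_diff_open: "compactin \<tau> C \<Longrightarrow> openin \<tau> U \<Longrightarrow> compactin \<tau> (C - U)"
  by (rule closed_compactin[of _ C]) (simp_all add: closedin_diff compactin_closedin Diff_subset)

lemma m_mono: "A \<in> sets borel \<Longrightarrow> B \<in> sets borel \<Longrightarrow> A \<subseteq> B \<Longrightarrow> m A \<le> m B"
proof -
  assume A: "A \<in> sets borel" and B: "B \<in> sets borel" and AB: "A \<subseteq> B"
  have "m (A \<union> (B - A)) = m A + m (B - A)"
    using A B by (intro m_Un) auto
  then show ?thesis using m_nonneg[of "B - A"] A B AB by (simp add: Un_absorb1)
qed

lemma m_empty: "m {} = 0"
  using m_Un[of "{}" "{}"] by simp

lemma m_modular:
  assumes A: "A \<in> sets borel" and B: "B \<in> sets borel"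
  shows "m (A \<union> B) + m (A \<inter> B) = m A + m B"
proof -
  have "m (A \<union> (B - A)) = m A + m (B - A)"
    using A B by (intro m_Un) auto
  moreover have "m ((A \<inter> B) \<union> (B - A)) = m (A \<inter> B) + m (B - A)"
    using A B by (intro m_Un) auto
  moreover have "(A \<inter> B) \<union> (B - A) = B" by blast
  ultimately show ?thesis by simp
qed

text \<open>Regularising \<open>m\<close> from outside by \<open>\<tau>\<close>-open sets makes it continuous along decreasing sequences of
  compact sets and tight, which is what countable additivity of the extension rests on.\<close>

definition cont :: "'a set \<Rightarrow> real" where
  "cont C = (INF U\<in>{U. openin \<tau> U \<and> C \<subseteq> U}. m U)"

lemma open_nbhds_nonempty: "{U. openin \<tau> U \<and> C \<subseteq> U} \<noteq> {}"
  using openin_topspace[of \<tau>] by simp blast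

lemma open_nbhds_bdd: "bdd_below (m ` {U. openin \<tau> U \<and> C \<subseteq> U})"
  by (intro bdd_belowI[of _ 0]) (auto intro: m_nonneg openin_borel)

lemma cont_le: "openin \<tau> U \<Longrightarrow> C \<subseteq> U \<Longrightarrow> cont C \<le> m U"
  unfolding cont_def by (intro cINF_lower open_nbhds_bdd) auto

lemma cont_greatest: "(\<And>U. openin \<tau> U \<Longrightarrow> C \<subseteq> U \<Longrightarrow> c \<le> m U) \<Longrightarrow> c \<le> cont C"
  unfolding cont_def by (intro cINF_greatest open_nbhds_nonempty) auto

lemma cont_approx:
  assumes "e > 0"
  obtains U where "openin \<tau> U" "C \<subseteq> U" "m U < cont C + e"
proof -
  have "\<not> (\<forall>U. openin \<tau> U \<longrightarrow> C \<subseteq> U \<longrightarrow> cont C + e \<le> m U)"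
  proof
    assume "\<forall>U. openin \<tau> U \<longrightarrow> C \<subseteq> U \<longrightarrow> cont C + e \<le> m U"
    then have "cont C + e \<le> cont C" by (intro cont_greatest) auto
    with assms show False by simp
  qed
  then show ?thesis using that by (meson not_le)
qed

lemma cont_nonneg: "0 \<le> cont C"
  by (intro cont_greatest m_nonneg openin_borel)

lemma cont_le_total: "cont C \<le> m UNIV"
  using openin_topspace[of \<tau>] by (intro cont_le) simp_all

lemma cont_empty [simp]: "cont {} = 0"
  using cont_le[of "{}" "{}"] cont_nonneg[of "{}"] by (simp add: m_empty)

lemma m_le_cont: "C \<in> sets borel \<Longrightarrow> m C \<le> cont C"
  by (intro cont_greatest m_mono) (auto intro: openin_borel)

lemma cont_mono: "C \<subseteq> D \<Longrightarrow> cont C \<le> cont D"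
  by (intro cont_greatest cont_le) auto

section \<open>Modularity, tightness and continuity of the content\<close>

lemma cont_submodular: "cont (C \<union> D) + cont (C \<inter> D) \<le> cont C + cont D"
proof (rule field_le_epsilon)
  fix e :: real assume "e > 0"
  then have e: "e / 2 > 0" by simp
  obtain U where U: "openin \<tau> U" "C \<subseteq> U" "m U < cont C + e / 2"
    using cont_approx[OF e] .
  obtain V where V: "openin \<tau> V" "D \<subseteq> V" "m V < cont D + e / 2"
    using cont_approx[OF e] .
  have "cont (C \<union> D) \<le> m (U \<union> V)" using U V by (intro cont_le) auto
  moreover have "cont (C \<inter> D) \<le> m (U \<inter> V)" using U V by (intro cont_le) auto
  ultimately show "cont (C \<union> D) + cont (C \<inter> D) \<le> cont C + cont D + e"
    using U V m_modular[OF openin_borel[OF U(1)] openin_borel[OF V(1)]] by linarith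
qed

text \<open>Disjoint compact sets of a Hausdorff space have disjoint open neighbourhoods, and
  \<open>m\<close> is additive on those.\<close>

lemma cont_disjoint:
  assumes "compactin \<tau> C" "compactin \<tau> D" "C \<inter> D = {}"
  shows "cont C + cont D \<le> cont (C \<union> D)"
proof (rule cont_greatest)
  fix W assume W: "openin \<tau> W" "C \<union> D \<subseteq> W"
  obtain U V where UV: "openin \<tau> U" "openin \<tau> V" "C \<subseteq> U" "D \<subseteq> V" "disjnt U V"
    using Hausdorff_space_compact_separation[OF Hausdorff assms(1,2)] assms(3)
    by (auto simp: disjnt_def)
  have "cont C + cont D \<le> m (W \<inter> U) + m (W \<inter> V)"
    using UV W by (intro add_mono cont_le) auto
  also have "\<dots> = m ((W \<inter> U) \<union> (W \<inter> V))"
    using UV W by (intro m_Un[symmetric]) (auto simp: disjnt_def openin_borel)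
  also have "\<dots> \<le> m W"
    using UV W by (intro m_mono) (auto intro: openin_borel)
  finally show "cont C + cont D \<le> m W" .
qed

text \<open>The witness is \<open>D - U\<close> for an open \<open>U\<close> nearly optimal for
  \<open>C\<close>: any open neighbourhood of \<open>D - U\<close> covers \<open>D\<close> once
  joined with \<open>U\<close>.\<close>

lemma cont_tight:
  assumes C: "compactin \<tau> C" and D: "compactin \<tau> D" and "e > 0"
  obtains E where "compactin \<tau> E" "E \<subseteq> D - C" "cont D \<le> cont C + cont E + e"
proof -
  obtain U where U: "openin \<tau> U" "C \<subseteq> U" "m U < cont C + e"
    using cont_approx[OF \<open>e > 0\<close>] .
  have "cont D - m U \<le> cont (D - U)"
  proof (rule cont_greatest)
    fix V assume V: "openin \<tau> V" "D - U \<subseteq> V"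
    have "cont D \<le> m (U \<union> V)" using U V by (intro cont_le) auto
    also have "\<dots> \<le> m U + m V"
      using m_modular[OF openin_borel[OF U(1)] openin_borel[OF V(1)]]
        m_nonneg[of "U \<inter> V"] openin_borel[OF U(1)] openin_borel[OF V(1)] by auto
    finally show "cont D - m U \<le> m V" by simp
  qed
  then show ?thesis
    using U compactin_diff_open[OF D U(1)] by (intro that[of "D - U"]) auto
qed

text \<open>Tightness peels off from \<open>C\<close> a compact part \<open>E\<close> disjoint from
  \<open>D\<close> that carries almost all of \<open>cont C - cont (C \<inter> D)\<close>. Together
  with \<open>cont_submodular\<close>, \<open>cont\<close> is modular on compact sets.\<close>

lemma cont_supermodular:
  assumes C: "compactin \<tau> C" and D: "compactin \<tau> D"
  shows "cont C + cont D \<le> cont (C \<union> D) + cont (C \<inter> D)"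
proof (rule field_le_epsilon)
  fix e :: real assume "e > 0"
  obtain E where E: "compactin \<tau> E" "E \<subseteq> C - (C \<inter> D)" "cont C \<le> cont (C \<inter> D) + cont E + e"
    using cont_tight[OF compactin_Int_cl[OF C D] C \<open>e > 0\<close>] .
  have "cont E + cont D \<le> cont (E \<union> D)"
    using E D by (intro cont_disjoint) auto
  also have "\<dots> \<le> cont (C \<union> D)"
    using E by (intro cont_mono) auto
  finally show "cont C + cont D \<le> cont (C \<union> D) + cont (C \<inter> D) + e"
    using E(3) by simp
qed

text \<open>An open set nearly optimal for the intersection already contains some
  \<open>C n\<close>. Otherwise the sets \<open>C n - U\<close> would be nested, nonempty and closed
  in the compact \<open>C 0\<close>, so they would share a point.\<close>

lemma cont_INT:
  assumes C: "\<And>n::nat. compactin \<tau> (C n)" and "decseq C" and "e > 0"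
  shows "\<exists>n. cont (C n) \<le> cont (\<Inter>n. C n) + e"
proof -
  obtain U where U: "openin \<tau> U" "(\<Inter>n. C n) \<subseteq> U" "m U < cont (\<Inter>n. C n) + e"
    using cont_approx[OF \<open>e > 0\<close>] .
  have "\<exists>n. C n \<subseteq> U"
  proof (rule ccontr)
    assume neg: "\<not> ?thesis"
    have "(\<Inter>n. C n - U) \<noteq> {}"
    proof (rule compact_space_imp_nest)
      show "compact_space (subtopology \<tau> (C 0))"
        using C[of 0] by (simp add: compactin_subspace)
      show "closedin (subtopology \<tau> (C 0)) (C n - U)" for n
        using compactin_closedin[OF compactin_diff_open[OF C U(1)], of n] \<open>decseq C\<close>
        by (auto simp: decseq_def closedin_closed_subtopology intro!: closedin_subset_topspace)
      show "C n - U \<noteq> {}" for n using neg by blast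
      show "decseq (\<lambda>n. C n - U)" using \<open>decseq C\<close> by (fastforce simp: decseq_def)
    qed
    then show False using U(2) by blast
  qed
  then obtain n where "C n \<subseteq> U" by blast
  then have "cont (C n) \<le> m U" using U by (intro cont_le)
  then show ?thesis using U(3) by (intro exI[of _ n]) simp
qed

section \<open>The outer measure induced by the content\<close>

text \<open>This can be smaller than \<open>m UNIV\<close>: whatever part of \<open>m\<close> no
  compact set holds is lost. Hence the extension has to be normalised later.\<close>

definition mass :: real where "mass = (SUP C\<in>{C. compactin \<tau> C}. cont C)"

lemma cont_bdd: "bdd_above (cont ` {C. compactin \<tau> C})"
  by (intro bdd_aboveI[of _ "m UNIV"]) (auto intro: cont_le_total)

lemma cont_le_mass: "compactin \<tau> C \<Longrightarrow> cont C \<le> mass"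
  unfolding mass_def by (intro cSUP_upper cont_bdd) auto

lemma mass_le: "mass \<le> m UNIV"
  unfolding mass_def by (intro cSUP_least) (auto intro: cont_le_total exI[of _ "{}"])

lemma mass_approx:
  assumes "e > 0"
  obtains C where "compactin \<tau> C" "mass < cont C + e"
proof -
  have "\<exists>x\<in>cont ` {C. compactin \<tau> C}. mass - e < x"
    unfolding mass_def using assms
    by (subst less_cSup_iff[symmetric]) (auto intro: cont_bdd exI[of _ "{}"])
  then show ?thesis using that by force
qed

text \<open>Complementary to the inner measure \<open>A \<mapsto> sup {cont C | C \<subseteq> A compact}\<close>.\<close>

definition outer :: "'a set \<Rightarrow> ennreal" where
  "outer A = (INF C\<in>{C. compactin \<tau> C \<and> C \<inter> A = {}}. ennreal (mass - cont C))"

lemma outer_le: "compactin \<tau> C \<Longrightarrow> C \<inter> A = {} \<Longrightarrow> outer A \<le> ennreal (mass - cont C)"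
  unfolding outer_def by (intro INF_lower) auto

lemma outer_greatest:
  "(\<And>C. compactin \<tau> C \<Longrightarrow> C \<inter> A = {} \<Longrightarrow> c \<le> ennreal (mass - cont C)) \<Longrightarrow> c \<le> outer A"
  unfolding outer_def by (intro INF_greatest) auto

lemma outer_mono: "A \<subseteq> B \<Longrightarrow> outer A \<le> outer B"
  by (intro outer_greatest outer_le) auto

lemma outer_UNIV: "outer UNIV = ennreal mass"
  by (auto simp: outer_def INF_constant)

lemma outer_finite: "outer A < \<top>"
  by (rule le_less_trans[OF outer_le[of "{}" A]]) simp_all

lemma outer_empty: "outer {} = 0"
proof -
  have "outer {} \<le> ennreal e" if "e > 0" for e
  proof -
    obtain C where C: "compactin \<tau> C" "mass < cont C + e" using mass_approx[OF \<open>e > 0\<close>] .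
    have "outer {} \<le> ennreal (mass - cont C)" using C by (intro outer_le) auto
    also have "\<dots> \<le> ennreal e" using C by (intro ennreal_leI) auto
    finally show ?thesis .
  qed
  then have "outer {} \<le> 0 + ennreal e" if "e > 0" for e using that by simp
  then have "outer {} \<le> 0" by (rule ennreal_le_epsilon)
  then show ?thesis by simp
qed

lemma outer_approx:
  assumes "e > 0"
  obtains C where "compactin \<tau> C" "C \<inter> A = {}" "mass - cont C \<le> enn2real (outer A) + e"
proof -
  have "outer A < outer A + ennreal e"
    using outer_finite[of A] assms ennreal_add_left_cancel_less[of "outer A" 0 "ennreal e"] by simp
  then obtain C where C: "compactin \<tau> C" "C \<inter> A = {}" "ennreal (mass - cont C) < outer A + ennreal e"
    unfolding outer_def INF_less_iff by blast
  have "outer A = ennreal (enn2real (outer A))" using outer_finite[of A] by simp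
  then have eq: "outer A + ennreal e = ennreal (enn2real (outer A) + e)"
    using assms by (metis ennreal_plus enn2real_nonneg less_imp_le)
  have "mass - cont C < enn2real (outer A) + e"
    using C(3) cont_le_mass[OF C(1)] unfolding eq by (subst (asm) ennreal_less_iff) auto
  with C that show ?thesis by force
qed

text \<open>Supermodularity says that the deficiency \<open>mass - cont C\<close> is subadditive
  under intersection. Compactness is carried through the induction because the next use of
  supermodularity requires it.\<close>

lemma mass_minus_cont_INT_finite:
  assumes "\<And>n::nat. compactin \<tau> (C n)"
  shows "mass - cont (\<Inter>i\<le>n. C i) \<le> (\<Sum>i\<le>n. mass - cont (C i)) \<and> compactin \<tau> (\<Inter>i\<le>n. C i)"
proof (induction n)
  case (Suc n)
  let ?D = "\<Inter>i\<le>n. C i"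
  have eq: "(\<Inter>i\<le>Suc n. C i) = ?D \<inter> C (Suc n)" by (auto simp: atMost_Suc)
  have "cont ?D + cont (C (Suc n)) \<le> cont (?D \<union> C (Suc n)) + cont (?D \<inter> C (Suc n))"
    using Suc assms by (intro cont_supermodular) auto
  also have "\<dots> \<le> mass + cont (?D \<inter> C (Suc n))"
    using Suc assms by (intro add_right_mono cont_le_mass compactin_Un) auto
  finally have "mass - cont (?D \<inter> C (Suc n)) \<le> (\<Sum>i\<le>Suc n. mass - cont (C i))"
    using Suc by simp
  then show ?case unfolding eq using Suc assms by (auto intro: compactin_Int_cl)
qed (use assms in auto)

text \<open>If compact \<open>C n\<close> avoids \<open>A n\<close>, then the intersection of all
  \<open>C n\<close> avoids the union of all \<open>A n\<close>. Its deficiency is controlled on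
  finite intersections, and \<open>cont_INT\<close> passes to the infinite one.\<close>

lemma outer_UN_le: "outer (\<Union>n. A n) \<le> (\<Sum>n. outer (A n))"
proof (cases "(\<Sum>n. outer (A n)) = \<top>")
  case False
  let ?r = "\<lambda>n. enn2real (outer (A n))"
  have r: "outer (A n) = ennreal (?r n)" for n using outer_finite[of "A n"] by simp
  have summ: "summable ?r"
    using False by (subst (asm) r) (auto intro: summable_suminf_not_top)
  have sum_eq: "(\<Sum>n. outer (A n)) = ennreal (\<Sum>n. ?r n)"
    by (subst r) (auto intro: suminf_ennreal2 summ)
  show ?thesis
  proof (rule ennreal_le_epsilon)
    fix e :: real assume "e > 0"
    \<comment> \<open>These errors add up to \<open>e/2\<close>; the other \<open>e/2\<close> pays
      for passing from a finite to the infinite intersection.\<close>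
    have "\<exists>C. compactin \<tau> C \<and> C \<inter> A n = {} \<and> mass - cont C \<le> ?r n + (e/2) * (1/2)^Suc n" for n
      using outer_approx[of "(e/2) * (1/2)^Suc n" "A n"] \<open>e > 0\<close> by auto
    then obtain C where C: "\<And>n. compactin \<tau> (C n)" "\<And>n. C n \<inter> A n = {}"
      "\<And>n. mass - cont (C n) \<le> ?r n + (e/2) * (1/2)^Suc n" by metis
    let ?D = "\<lambda>n. \<Inter>i\<le>n. C i"
    have INT: "(\<Inter>n. ?D n) = (\<Inter>n. C n)" by auto
    have "\<exists>n. cont (?D n) \<le> cont (\<Inter>n. ?D n) + e/2"
      using mass_minus_cont_INT_finite[of C] C(1) \<open>e > 0\<close>
      by (intro cont_INT) (auto simp: decseq_def)
    then obtain n where n: "cont (?D n) \<le> cont (\<Inter>n. C n) + e/2" unfolding INT by blast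
    have sums: "(\<lambda>n. (e/2) * (1/2)^Suc n) sums (e/2)"
      using sums_mult[OF power_half_series, of "e/2"] by simp
    have "mass - cont (\<Inter>n. C n) \<le> mass - cont (?D n) + e/2" using n by simp
    also have "\<dots> \<le> (\<Sum>i\<le>n. mass - cont (C i)) + e/2"
      using mass_minus_cont_INT_finite[of C n] C(1) by simp
    also have "\<dots> \<le> (\<Sum>i\<le>n. ?r i + (e/2) * (1/2)^Suc i) + e/2"
      by (intro add_right_mono sum_mono C(3))
    also have "\<dots> \<le> (\<Sum>i. ?r i + (e/2) * (1/2)^Suc i) + e/2"
      using \<open>e > 0\<close> by (intro add_right_mono sum_le_suminf summable_add summ sums_summable[OF sums]) auto
    also have "\<dots> = (\<Sum>i. ?r i) + e"
      using suminf_add[OF summ sums_summable[OF sums]] sums_unique[OF sums] by simp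
    finally have le: "mass - cont (\<Inter>n. C n) \<le> (\<Sum>i. ?r i) + e" .
    have "compactin \<tau> (\<Inter>n. C n)"
      using C(1) compactin_closedin by (intro closed_compactin_Inter[of \<tau> "C 0"]) auto
    then have "outer (\<Union>n. A n) \<le> ennreal (mass - cont (\<Inter>n. C n))"
      using C(2) by (intro outer_le) auto
    also have "\<dots> \<le> ennreal ((\<Sum>i. ?r i) + e)" using le by (rule ennreal_leI)
    also have "\<dots> = (\<Sum>n. outer (A n)) + ennreal e"
      unfolding sum_eq using \<open>e > 0\<close> summ by (intro ennreal_plus suminf_nonneg) auto
    finally show "outer (\<Union>n. A n) \<le> (\<Sum>n. outer (A n)) + ennreal e" .
  qed
qed simp

lemma outer_measure_space_outer: "outer_measure_space UNIV outer"
  unfolding outer_measure_space_def positive_def increasing_def countably_subadditive_def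
  by (auto simp: outer_empty outer_mono outer_UN_le)

text \<open>This is the nontrivial half of Caratheodory's criterion for compact sets. It follows
  from submodularity, applied to one compact set avoiding \<open>A \<inter> C\<close> and one
  avoiding \<open>A - C\<close>.\<close>

lemma outer_split_compact:
  assumes C: "compactin \<tau> C"
  shows "outer (A \<inter> C) + outer (A - C) \<le> outer A"
proof (rule ennreal_le_epsilon)
  fix e :: real assume "e > 0"
  then have e: "e / 3 > 0" by simp
  obtain C' where C': "compactin \<tau> C'" "C' \<inter> A = {}" "mass - cont C' \<le> enn2real (outer A) + e/3"
    using outer_approx[OF e] .
  obtain D where D: "compactin \<tau> D" "mass < cont D + e/3" using mass_approx[OF e] .
  obtain C'' where C'': "compactin \<tau> C''" "C'' \<subseteq> D - C" "cont D \<le> cont C + cont C'' + e/3"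
    using cont_tight[OF C D(1) e] .
  \<comment> \<open>\<open>?C1\<close> avoids \<open>A \<inter> C\<close> and \<open>?C2\<close>
    avoids \<open>A - C\<close>. Their union contains \<open>C \<union> C''\<close>, which has
    nearly full content, and their intersection contains \<open>C'\<close>, which is nearly optimal
    for \<open>A\<close>.\<close>
  let ?C1 = "C' \<union> C''" and ?C2 = "C \<union> C'"
  have c12: "compactin \<tau> ?C1" "compactin \<tau> ?C2" using C C' C'' by (auto intro: compactin_Un)
  have "cont C + cont C'' \<le> cont (C \<union> C'')" using C C'' by (intro cont_disjoint) auto
  also have "\<dots> \<le> cont (?C1 \<union> ?C2)" by (intro cont_mono) auto
  finally have "mass - 2 * (e/3) \<le> cont (?C1 \<union> ?C2)" using C''(3) D by simp
  moreover have "cont C' \<le> cont (?C1 \<inter> ?C2)" by (intro cont_mono) auto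
  moreover note cont_submodular[of ?C1 ?C2]
  ultimately have le: "(mass - cont ?C1) + (mass - cont ?C2) \<le> enn2real (outer A) + e"
    using C'(3) by linarith
  have "outer (A \<inter> C) + outer (A - C) \<le> ennreal (mass - cont ?C1) + ennreal (mass - cont ?C2)"
    using C' C'' c12 by (intro add_mono outer_le) auto
  also have "\<dots> = ennreal ((mass - cont ?C1) + (mass - cont ?C2))"
    using c12 by (intro ennreal_plus[symmetric]) (auto simp: cont_le_mass)
  also have "\<dots> \<le> ennreal (enn2real (outer A) + e)" using le by (rule ennreal_leI)
  also have "\<dots> = outer A + ennreal e"
    using \<open>e > 0\<close> outer_finite[of A] by (subst ennreal_plus) auto
  finally show "outer (A \<inter> C) + outer (A - C) \<le> outer A + ennreal e" .
qed

lemma outer_subadd: "A \<inter> B = {} \<Longrightarrow> outer (A \<union> B) \<le> outer A + outer B"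
proof -
  interpret sigma_algebra UNIV "UNIV :: 'a set set"
    using sigma_algebra_Pow[of UNIV] by simp
  have "subadditive UNIV outer"
    using outer_measure_space_outer unfolding outer_measure_space_def
    by (intro countably_subadditive_subadditive) auto
  moreover assume "A \<inter> B = {}"
  ultimately show ?thesis by (simp add: subadditive_def)
qed

section \<open>The Caratheodory extension\<close>

definition extension :: "'a measure" where
  "extension = measure_of UNIV (sets borel) outer"

lemma sets_extension [simp]: "sets extension = sets borel"
  unfolding extension_def using sets.sigma_sets_eq[of borel] by (simp add: sets_measure_of_conv)

lemma space_extension [simp]: "space extension = UNIV"
  unfolding extension_def by (simp add: space_measure_of_conv)

text \<open>The sets that split every set additively form a sigma-algebra on which
  \<open>outer\<close> is a measure. It contains the compact sets, hence all Borel sets, which they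
  generate.\<close>

lemma emeasure_extension: "A \<in> sets borel \<Longrightarrow> emeasure extension A = outer A"
proof -
  interpret sigma_algebra UNIV "UNIV :: 'a set set"
    using sigma_algebra_Pow[of UNIV] by simp
  let ?L = "lambda_system UNIV UNIV outer"
  have ms: "measure_space UNIV ?L outer"
    by (rule caratheodory_lemma[OF outer_measure_space_outer])
  then have sa: "sigma_algebra UNIV ?L" by (simp add: measure_space_def)
  have "{C. compactin \<tau> C} \<subseteq> ?L"
  proof safe
    fix C assume C: "compactin \<tau> C"
    have "outer (A \<inter> C) + outer (A - C) = outer A" for A
      using outer_split_compact[OF C, of A] outer_subadd[of "A \<inter> C" "A - C"]
      by (intro antisym) (auto simp: Int_Diff_Un Int_Diff_disjoint)
    then show "C \<in> ?L" by (auto simp: lambda_system_eq)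
  qed
  then have sub: "sets borel \<subseteq> ?L"
    unfolding borel_generated by (rule sigma_algebra.sigma_sets_subset[OF sa])
  have "countably_additive (sets borel) outer"
    using ms sub unfolding measure_space_def countably_additive_def by blast
  moreover have "positive (sets borel) outer" by (simp add: positive_def outer_empty)
  moreover assume "A \<in> sets borel"
  ultimately show ?thesis
    by (intro emeasure_measure_of[OF extension_def]) auto
qed

text \<open>A compact \<open>D\<close> disjoint from \<open>C\<close> satisfies
  \<open>cont D + cont C \<le> mass\<close>, so \<open>cont C\<close> is below every term of the
  infimum defining \<open>outer C\<close>.\<close>

lemma cont_le_emeasure_extension:
  assumes C: "compactin \<tau> C"
  shows "ennreal (cont C) \<le> emeasure extension C"
  unfolding emeasure_extension[OF compactin_borel[OF C]]
proof (rule outer_greatest)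
  fix D assume D: "compactin \<tau> D" "D \<inter> C = {}"
  have "cont D + cont C \<le> cont (D \<union> C)" using C D by (intro cont_disjoint) auto
  also have "\<dots> \<le> mass" using C D by (intro cont_le_mass compactin_Un) auto
  finally show "ennreal (cont C) \<le> ennreal (mass - cont D)" by (intro ennreal_leI) simp
qed

end

section \<open>The maximal ergodic inequality and frequent recurrence\<close>

lemma invariant_measureD:
  assumes "invariant_measure T M"
  shows "sets M = sets borel" "space M = UNIV" "prob_space M" "T \<in> borel_measurable borel"
    "T \<in> measurable M M" "\<And>A. A \<in> sets borel \<Longrightarrow> emeasure M (T -` A) = emeasure M A"
proof -
  show *: "sets M = sets borel" "prob_space M" "T \<in> borel_measurable borel"
    "\<And>A. A \<in> sets borel \<Longrightarrow> emeasure M (T -` A) = emeasure M A"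
    using assms by (auto simp: invariant_measure_def borel_prob_def)
  show "space M = UNIV" using sets_eq_imp_space_eq[OF *(1)] by simp
  show "T \<in> measurable M M" using *(3) measurable_cong_sets[OF *(1) *(1)] by simp
qed

lemma integral_invariant_comp:
  fixes f :: "'a::topological_space \<Rightarrow> real"
  assumes M: "invariant_measure T M" and f: "f \<in> borel_measurable borel"
  shows "(\<integral>x. f (T x) \<partial>M) = (\<integral>x. f x \<partial>M)"
proof -
  note D = invariant_measureD[OF M]
  have "distr M M T = M"
    using D by (intro measure_eqI) (auto simp: emeasure_distr)
  moreover have "(\<integral>x. f x \<partial>distr M M T) = (\<integral>x. f (T x) \<partial>M)"
    using D(5) f measurable_cong_sets[OF D(1) refl] by (intro integral_distr) auto
  ultimately show ?thesis by simp
qed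

section \<open>Running maxima of Birkhoff sums\<close>

text \<open>The maximum of the Birkhoff sums of lengths \<open>0\<close> to \<open>n\<close>, the
  empty sum included. The recursive form is the identity on which Garsia's argument rests.\<close>

primrec max_birkhoff_sum :: "('a \<Rightarrow> 'a) \<Rightarrow> ('a \<Rightarrow> real) \<Rightarrow> nat \<Rightarrow> 'a \<Rightarrow> real" where
  "max_birkhoff_sum T f 0 x = 0"
| "max_birkhoff_sum T f (Suc n) x = max 0 (f x + max_birkhoff_sum T f n (T x))"

lemma birkhoff_sum_Suc:
  "(\<Sum>k<Suc n. f ((T ^^ k) x)) = f x + (\<Sum>k<n. f ((T ^^ k) (T x)))" for f :: "'a \<Rightarrow> real"
  by (simp only: sum.lessThan_Suc_shift funpow_Suc_right) simp

lemma birkhoff_sum_le_max: "(\<Sum>k<n. f ((T ^^ k) x)) \<le> max_birkhoff_sum T f n x"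
proof (induction n arbitrary: x)
  case (Suc n)
  show ?case unfolding birkhoff_sum_Suc using Suc[of "T x"] by simp
qed simp

lemma max_birkhoff_sum_attained: "\<exists>k\<le>n. max_birkhoff_sum T f n x = (\<Sum>i<k. f ((T ^^ i) x))"
proof (induction n arbitrary: x)
  case (Suc n)
  obtain k where k: "k \<le> n" "max_birkhoff_sum T f n (T x) = (\<Sum>i<k. f ((T ^^ i) (T x)))"
    using Suc by blast
  show ?case
  proof (cases "f x + max_birkhoff_sum T f n (T x) \<le> 0")
    case False
    then have "max_birkhoff_sum T f (Suc n) x = (\<Sum>i<Suc k. f ((T ^^ i) x))"
      unfolding birkhoff_sum_Suc using k by simp
    then show ?thesis using k(1) by (intro exI[of _ "Suc k"]) simp
  qed (auto intro!: exI[of _ 0])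
qed simp

lemma max_birkhoff_sum_nonneg: "0 \<le> max_birkhoff_sum T f n x"
  by (cases n) auto

lemma max_birkhoff_sum_le_Suc: "max_birkhoff_sum T f n x \<le> max_birkhoff_sum T f (Suc n) x"
proof (induction n arbitrary: x)
  case (Suc n)
  have "max 0 (f x + max_birkhoff_sum T f n (T x)) \<le> max 0 (f x + max_birkhoff_sum T f (Suc n) (T x))"
    using Suc[of "T x"] by (intro max.mono) simp_all
  then show ?case by simp
qed simp

lemma incseq_max_birkhoff_sum: "incseq (\<lambda>n. max_birkhoff_sum T f n x)"
  by (intro incseq_SucI max_birkhoff_sum_le_Suc)

lemma max_birkhoff_sum_le:
  assumes "\<And>x. \<bar>f x\<bar> \<le> B"
  shows "max_birkhoff_sum T f n x \<le> real n * B"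
proof (induction n arbitrary: x)
  case (Suc n)
  have "0 \<le> B" using assms[of x] by linarith
  then show ?case using Suc[of "T x"] assms[of x] by (auto simp: algebra_simps)
qed simp

lemma measurable_max_birkhoff_sum:
  assumes [measurable]: "T \<in> borel_measurable borel" "f \<in> borel_measurable borel"
  shows "max_birkhoff_sum T f n \<in> borel_measurable borel"
proof (induction n)
  case (Suc n)
  note [measurable] = Suc
  show ?case by (simp add: fun_eq_iff cong: measurable_cong) measurable
qed simp

text \<open>Garsia's argument: where \<open>max_birkhoff_sum T f (Suc n)\<close> is positive, \<open>f\<close> equals its
  difference with \<open>max_birkhoff_sum T f n \<circ> T\<close>; elsewhere that difference is non-positive.\<close>

lemma maximal_ergodic_inequality:
  fixes f :: "'a::topological_space \<Rightarrow> real"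
  assumes M: "invariant_measure T M" and f [measurable]: "f \<in> borel_measurable borel"
    and B: "\<And>x. \<bar>f x\<bar> \<le> B"
  shows "0 \<le> (\<integral>x. f x * indicator {x. \<exists>n. 0 < (\<Sum>k<n. f ((T ^^ k) x))} x \<partial>M)"
proof -
  note D = invariant_measureD[OF M]
  interpret prob_space M by (rule D)
  note [measurable] = D(4) measurable_max_birkhoff_sum[OF D(4) f]
  have mc: "g \<in> borel_measurable M \<longleftrightarrow> g \<in> borel_measurable borel" for g :: "'a \<Rightarrow> real"
    using measurable_cong_sets[OF D(1) refl] by blast
  let ?P = "max_birkhoff_sum T f"
  let ?I = "\<lambda>n x. indicator {x. 0 < ?P n x} x :: real"
  have intP: "integrable M (?P n)" for n
    using max_birkhoff_sum_le[where f=f and B=B, OF B] max_birkhoff_sum_nonneg[of T f]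
    by (intro integrable_const_bound[of _ "real n * B"]) (auto simp: mc)
  have intPT: "integrable M (\<lambda>x. ?P n (T x))" for n
    using max_birkhoff_sum_le[where f=f and B=B, OF B] max_birkhoff_sum_nonneg[of T f]
    by (intro integrable_const_bound[of _ "real n * B"]) (auto simp: mc)
  have B0: "0 \<le> B" using B order_trans abs_ge_zero by blast
  have intI: "integrable M (\<lambda>x. f x * ?I n x)" for n
    using B B0 by (intro integrable_const_bound[of _ B]) (auto simp: mc indicator_def)
  have ge: "0 \<le> (\<integral>x. f x * ?I n x \<partial>M)" for n
  proof (cases n)
    case (Suc k)
    have "0 \<le> (\<integral>x. ?P (Suc k) x \<partial>M) - (\<integral>x. ?P k x \<partial>M)"
      using integral_mono[OF intP[of k] intP[of "Suc k"] max_birkhoff_sum_le_Suc] by simp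
    also have "\<dots> = (\<integral>x. ?P (Suc k) x \<partial>M) - (\<integral>x. ?P k (T x) \<partial>M)"
      by (subst integral_invariant_comp[OF M, of "?P k"]) simp_all
    also have "\<dots> = (\<integral>x. ?P (Suc k) x - ?P k (T x) \<partial>M)"
      by (rule Bochner_Integration.integral_diff[symmetric, OF intP intPT])
    also have "\<dots> \<le> (\<integral>x. f x * ?I (Suc k) x \<partial>M)"
    proof (intro integral_mono Bochner_Integration.integrable_diff intP intPT intI)
      fix x
      show "?P (Suc k) x - ?P k (T x) \<le> f x * ?I (Suc k) x"
        using max_birkhoff_sum_nonneg[of T f k "T x"] by (auto simp: indicator_def max_def)
    qed
    finally show ?thesis using Suc by simp
  qed simp
  \<comment> \<open>The set in the statement is thus the increasing union of the sets where
    \<open>?P n\<close> is positive, and dominated convergence transfers \<open>ge\<close> to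
    it.\<close>
  have ex_iff: "(\<exists>n. 0 < (\<Sum>k<n. f ((T ^^ k) x))) \<longleftrightarrow> (\<exists>n. 0 < ?P n x)" for x
    by (metis birkhoff_sum_le_max max_birkhoff_sum_attained less_le_trans)
  have lim: "(\<lambda>n. f x * ?I n x) \<longlonglongrightarrow> f x * indicator {x. \<exists>n. 0 < ?P n x} x" for x
  proof (cases "\<exists>n. 0 < ?P n x")
    case True
    then obtain n where n: "0 < ?P n x" by blast
    have "0 < ?P k x" if "k \<ge> n" for k
      using incseqD[OF incseq_max_birkhoff_sum that, of T f x] n by linarith
    then have "eventually (\<lambda>k. f x * ?I k x = f x * indicator {x. \<exists>n. 0 < ?P n x} x) sequentially"
      using n by (intro eventually_sequentiallyI[of n]) (auto simp: indicator_def)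
    then show ?thesis by (rule tendsto_eventually)
  qed (auto simp: indicator_def)
  have "(\<lambda>n. \<integral>x. f x * ?I n x \<partial>M) \<longlonglongrightarrow> (\<integral>x. f x * indicator {x. \<exists>n. 0 < ?P n x} x \<partial>M)"
    using B B0 lim
    by (intro integral_dominated_convergence[where w = "\<lambda>_. B"]) (auto simp: mc indicator_def)
  then have "0 \<le> (\<integral>x. f x * indicator {x. \<exists>n. 0 < ?P n x} x \<partial>M)"
    by (rule LIMSEQ_le_const) (use ge in auto)
  then show ?thesis unfolding ex_iff .
qed

section \<open>Lower density and recurrent points\<close>

lemma lower_density_mono:
  assumes "D \<subseteq> D'"
  shows "lower_density D \<le> lower_density D'"
proof -
  have "card (D \<inter> {1..N}) \<le> card (D' \<inter> {1..N})" for N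
    using assms by (intro card_mono) auto
  then show ?thesis
    unfolding lower_density_def by (intro Liminf_mono always_eventually) (simp add: divide_right_mono)
qed

lemma lower_density_pos:
  assumes c: "c > 0" and le: "\<And>N. N \<ge> N0 \<Longrightarrow> c * real N \<le> real (card (D \<inter> {1..N}))"
  shows "lower_density D > 0"
proof -
  have "ereal c \<le> lower_density D"
    unfolding lower_density_def
  proof (rule Liminf_bounded, rule eventually_sequentiallyI)
    fix N assume "N \<ge> max 1 N0"
    then show "ereal c \<le> ereal (real (card (D \<inter> {1..N})) / real N)"
      using le[of N] by (simp add: field_simps)
  qed
  moreover have "0 < ereal c" using c by simp
  ultimately show ?thesis by (rule less_le_trans[rotated])
qed

lemma lower_density_posD:
  assumes "lower_density D > 0"
  obtains c where "c > 0" "eventually (\<lambda>N. c \<le> real (card (D \<inter> {1..N})) / real N) sequentially"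
proof -
  obtain z where z: "0 < z" "z < lower_density D" using dense[OF assms] by blast
  then obtain c where c: "z = ereal c" by (cases z) auto
  have "eventually (\<lambda>N. z < ereal (real (card (D \<inter> {1..N})) / real N)) sequentially"
    using z(2) unfolding lower_density_def by (rule less_LiminfD)
  then have "eventually (\<lambda>N. c \<le> real (card (D \<inter> {1..N})) / real N) sequentially"
    by eventually_elim (simp add: c)
  then show ?thesis using that z c by simp
qed

text \<open>The maximal inequality is applied to \<open>f = (e - 1\<^sub>V) 1\<^sub>E\<close>, where \<open>E\<close> is the forward invariant set
  of points visiting \<open>V\<close> with lower density zero; it gives \<open>M (V \<inter> E) \<le> e\<close>.\<close>

lemma exists_frequently_recurrent_point:
  fixes T :: "'a::topological_space \<Rightarrow> 'a"
  assumes M: "invariant_measure T M" and V [measurable]: "V \<in> sets borel" and pos: "emeasure M V > 0"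
  shows "\<exists>x\<in>V. lower_density {n. (T ^^ n) x \<in> V} > 0"
proof -
  note D = invariant_measureD[OF M]
  interpret prob_space M by (rule D)
  note [measurable] = D(4)
  have mc: "g \<in> borel_measurable M \<longleftrightarrow> g \<in> borel_measurable borel" for g :: "'a \<Rightarrow> real"
    using measurable_cong_sets[OF D(1) refl] by blast
  define c where "c N x = (\<Sum>k<N. indicator V ((T ^^ k) x) :: real)" for N :: nat and x
  have [measurable]: "(T ^^ k) \<in> borel_measurable borel" for k
    by (induction k) (simp_all add: measurable_comp[OF _ D(4)])
  have [measurable]: "c N \<in> borel_measurable borel" for N
    unfolding c_def by measurable
  have c_Suc: "c (Suc N) x = indicator V x + c N (T x)" for N x
    unfolding c_def by (rule birkhoff_sum_Suc)
  \<comment> \<open>Positive lower density of visits, written with countable quantifiers over the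
    rates \<open>1 / Suc j\<close> so that measurability is immediate.\<close>
  define G where "G = {x. \<exists>j N0. \<forall>N\<ge>N0. real N / real (Suc j) \<le> c N x}"
  have [measurable]: "G \<in> sets borel"
    unfolding G_def by measurable
  \<comment> \<open>Prepending a point shifts time by one. Halving the rate, since
    \<open>Suc (2 * j + 1) = 2 * Suc j\<close>, absorbs this as soon as
    \<open>N \<ge> 2\<close>.\<close>
  have G_back: "x \<in> G" if "T x \<in> G" for x
  proof -
    from that obtain j N0 where N0: "\<And>N. N \<ge> N0 \<Longrightarrow> real N / real (Suc j) \<le> c N (T x)"
      unfolding G_def by blast
    have "real N / real (Suc (2 * j + 1)) \<le> c N x" if N: "N \<ge> N0 + 2" for N
    proof -
      obtain K where K: "N = Suc K" using N by (cases N) auto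
      have "real N / real (Suc (2 * j + 1)) \<le> real K / real (Suc j)"
        using N K mult_right_mono[of 1 "real K" "1 + real j"] by (simp add: field_simps)
      also have "\<dots> \<le> c K (T x)" using N K by (intro N0) auto
      also have "\<dots> \<le> c N x" unfolding K c_Suc by simp
      finally show ?thesis .
    qed
    then show ?thesis unfolding G_def by blast
  qed
  define E where "E = - G"
  have [measurable]: "E \<in> sets borel" unfolding E_def by measurable
  have E_forward: "(T ^^ k) x \<in> E" if "x \<in> E" for k x
    using that by (induction k) (auto simp: E_def dest: G_back)
  have bound: "measure M (V \<inter> E) \<le> e" if "e > 0" for e
  proof -
    define f where "f x = (e - indicator V x) * indicator E x" for x
    have [measurable]: "f \<in> borel_measurable borel" unfolding f_def by measurable
    \<comment> \<open>An orbit starting in \<open>E\<close> stays there, so the factor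
      \<open>indicator E\<close> is constantly 1 along it.\<close>
    have "0 < (\<Sum>k<n. f ((T ^^ k) x)) \<longleftrightarrow> c n x < real n * e" if "x \<in> E" for n x
      using E_forward[OF that] by (simp add: f_def c_def sum_subtractf)
    \<comment> \<open>A point outside \<open>G\<close> fails every rate, in particular some
      \<open>1 / Suc j\<close> below \<open>e\<close>. So the set in the maximal inequality contains
      \<open>E\<close>, and \<open>f\<close> vanishes off \<open>E\<close>.\<close>
    moreover have "\<exists>n. c n x < real n * e" if "x \<in> E" for x
    proof -
      obtain j where j: "inverse (real (Suc j)) < e" using reals_Archimedean[OF \<open>e > 0\<close>] by blast
      have "\<forall>N0. \<exists>N\<ge>N0. c N x < real N / real (Suc j)"
        using that unfolding E_def G_def by (simp add: not_le)
      then obtain N where "c N x < real N / real (Suc j)" by blast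
      also have "real N / real (Suc j) \<le> real N * e"
        unfolding divide_inverse using j by (intro mult_left_mono) auto
      finally show ?thesis by blast
    qed
    ultimately have "x \<in> E \<Longrightarrow> \<exists>n. 0 < (\<Sum>k<n. f ((T ^^ k) x))" for x by blast
    then have eq: "f x * indicator {x. \<exists>n. 0 < (\<Sum>k<n. f ((T ^^ k) x))} x = f x" for x
      by (cases "x \<in> E") (auto simp: f_def)
    have "0 \<le> (\<integral>x. f x * indicator {x. \<exists>n. 0 < (\<Sum>k<n. f ((T ^^ k) x))} x \<partial>M)"
      using \<open>e > 0\<close> by (intro maximal_ergodic_inequality[OF M, of _ "e + 1"]) (auto simp: f_def indicator_def)
    also have "\<dots> = (\<integral>x. f x \<partial>M)" unfolding eq ..
    also have "\<dots> = (\<integral>x. e * indicator E x - indicator (V \<inter> E) x \<partial>M)"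
      by (intro Bochner_Integration.integral_cong) (auto simp: f_def indicator_def)
    also have "\<dots> = e * measure M E - measure M (V \<inter> E)"
      using D(1) by (subst Bochner_Integration.integral_diff) (auto simp: emeasure_eq_measure D)
    finally have "measure M (V \<inter> E) \<le> e * measure M E" by simp
    also have "\<dots> \<le> e" using \<open>e > 0\<close> by (simp add: mult_left_le)
    finally show ?thesis .
  qed
  have "measure M (V \<inter> E) \<le> 0"
    by (rule field_le_epsilon) (simp add: bound)
  then have "emeasure M (V \<inter> E) = 0"
    by (simp add: emeasure_eq_measure measure_le_0_iff)
  moreover have "emeasure M V \<le> emeasure M (V \<inter> E)" if "V \<subseteq> E"
    using that by (simp add: Int_absorb2)
  ultimately obtain x where x: "x \<in> V" "x \<in> G" using pos unfolding E_def by fastforce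
  then obtain j N0 where N0: "\<And>N. N \<ge> N0 \<Longrightarrow> real N / real (Suc j) \<le> c N x"
    unfolding G_def by blast
  have "lower_density {n. (T ^^ n) x \<in> V} > 0"
  proof (rule lower_density_pos)
    \<comment> \<open>\<open>c\<close> counts from time 0 but \<open>lower_density\<close> from time
      1. Half the rate leaves room for the one visit that may be lost, once
      \<open>N \<ge> 2 * Suc j\<close>.\<close>
    show "0 < 1 / (2 * real (Suc j))" by simp
    fix N assume N: "N \<ge> max N0 (2 * Suc j)"
    let ?D = "{n. (T ^^ n) x \<in> V}"
    have "real (card (?D \<inter> {1..N})) = (\<Sum>k=1..N. indicator V ((T ^^ k) x))"
      by (simp add: indicator_def sum.If_cases Int_commute)
    also have "\<dots> = c (Suc N) x - indicator V x"
      unfolding c_def by (subst lessThan_Suc_atMost) (simp add: atMost_atLeast0 sum.atLeast_Suc_atMost)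
    finally have "real (card (?D \<inter> {1..N})) \<ge> c (Suc N) x - 1"
      by (simp add: indicator_def split: if_splits)
    moreover have "real (Suc N) / real (Suc j) \<le> c (Suc N) x" using N by (intro N0) auto
    moreover have "1 / (2 * real (Suc j)) * real N + 1 \<le> real (Suc N) / real (Suc j)"
    proof -
      define r where "r = real (Suc j)"
      have r: "r > 0" "2 * r \<le> real N" using N unfolding r_def by linarith+
      then have "real N / (2 * r) + 1 \<le> real N / r" by (simp add: field_simps)
      also have "\<dots> \<le> real (Suc N) / r" using r by (intro divide_right_mono) auto
      finally show ?thesis by (simp add: r_def)
    qed
    ultimately show "1 / (2 * real (Suc j)) * real N \<le> real (card (?D \<inter> {1..N}))" by linarith
  qed
  with x show ?thesis by blast
qed

section \<open>Invariant measures for compactly based systems\<close>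

locale compactly_based_system =
  fixes T :: "'a::polish_space \<Rightarrow> 'a" and \<tau> :: "'a topology"
  assumes cont_T: "continuous_on UNIV T"
    and topspace_tau: "topspace \<tau> = UNIV"
    and Hausdorff_tau: "Hausdorff_space \<tau>"
    and tau_coarser: "\<And>U. openin \<tau> U \<Longrightarrow> open U"
    and compact_nbhd: "\<And>x U. open U \<Longrightarrow> x \<in> U \<Longrightarrow> \<exists>K. compactin \<tau> K \<and> x \<in> interior K \<and> K \<subseteq> U"
    and cont_T_tau: "continuous_map \<tau> \<tau> T"
begin

lemma T_borel [measurable]: "T \<in> borel_measurable borel"
  using cont_T by (rule borel_measurable_continuous_onI)

section \<open>Compact sets as a generator of the Borel sets\<close>

lemma compact_closed: "compactin \<tau> C \<Longrightarrow> closed C"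
proof -
  assume "compactin \<tau> C"
  then have "closedin \<tau> C" by (rule compactin_imp_closedin[OF Hausdorff_tau])
  then have "openin \<tau> (- C)" by (simp add: closedin_def topspace_tau Compl_eq_Diff_UNIV)
  then show ?thesis using tau_coarser by (simp add: closed_def)
qed

lemma compact_borel: "compactin \<tau> C \<Longrightarrow> C \<in> sets borel"
  by (intro borel_closed compact_closed)

text \<open>For each pair of basic open sets \<open>U\<close>, \<open>W\<close> with a compact set
  in between, one such set is chosen. Every open set is a union of these countably many sets.
  Closing under finite intersections gives the pi-system on which measures are compared
  later.\<close>

lemma compact_generator:
  obtains \<K> where "countable \<K>" "\<And>C. C \<in> \<K> \<Longrightarrow> compactin \<tau> C" "Int_stable \<K>"
    "sets borel = sigma_sets UNIV \<K>" "\<Union>\<K> = UNIV"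
proof -
  obtain B :: "'a set set" where B: "countable B" "topological_basis B"
    using ex_countable_basis by blast
  let ?R = "\<lambda>U W K. compactin \<tau> K \<and> U \<subseteq> K \<and> K \<subseteq> W"
  define P where "P = {(U, W). U \<in> B \<and> W \<in> B \<and> (\<exists>K. ?R U W K)}"
  define k where "k = (\<lambda>(U, W). SOME K. ?R U W K)"
  have k: "?R U W (k (U, W))" if "(U, W) \<in> P" for U W
    using that someI_ex[of "?R U W"] unfolding P_def k_def by simp
  have "countable P"
    by (rule countable_subset[of _ "B \<times> B"]) (auto simp: P_def B)
  define \<K>0 where "\<K>0 = k ` P"
  have K0: "countable \<K>0" "\<And>C. C \<in> \<K>0 \<Longrightarrow> compactin \<tau> C"
    using \<open>countable P\<close> k by (auto simp: \<K>0_def)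
  have open_eq: "O' = \<Union>{C \<in> \<K>0. C \<subseteq> O'}" if O': "open O'" for O'
  proof (intro equalityI subsetI)
    fix x assume "x \<in> O'"
    then obtain W where W: "W \<in> B" "x \<in> W" "W \<subseteq> O'" using topological_basisE[OF B(2) O'] by metis
    obtain K where K: "compactin \<tau> K" "x \<in> interior K" "K \<subseteq> W"
      using compact_nbhd[of W x] topological_basis_open[OF B(2)] W by blast
    obtain U where U: "U \<in> B" "x \<in> U" "U \<subseteq> interior K"
      using topological_basisE[OF B(2) open_interior K(2)] by metis
    have "(U, W) \<in> P" using U W K interior_subset[of K] unfolding P_def by blast
    then show "x \<in> \<Union>{C \<in> \<K>0. C \<subseteq> O'}" using k[of U W] U W unfolding \<K>0_def by blast
  qed auto
  \<comment> \<open>The empty family is excluded because \<open>Inter {}\<close> is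
    \<open>UNIV\<close>, which need not be compact.\<close>
  define \<K> where "\<K> = Inter ` {F. F \<subseteq> \<K>0 \<and> finite F \<and> F \<noteq> {}}"
  have sub: "\<K>0 \<subseteq> \<K>"
  proof
    fix C assume "C \<in> \<K>0"
    then show "C \<in> \<K>" unfolding \<K>_def by (intro image_eqI[of _ _ "{C}"]) auto
  qed
  have "countable {F. F \<subseteq> \<K>0 \<and> finite F \<and> F \<noteq> {}}"
    by (rule countable_subset[OF _ countable_Collect_finite_subset[OF K0(1)]]) auto
  then have countable: "countable \<K>" unfolding \<K>_def by (rule countable_image)
  have comp: "compactin \<tau> C" if "C \<in> \<K>" for C
  proof -
    obtain F where F: "F \<subseteq> \<K>0" "F \<noteq> {}" "C = \<Inter>F" using \<open>C \<in> \<K>\<close> unfolding \<K>_def by blast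
    then obtain K where "K \<in> F" by blast
    then show ?thesis unfolding F(3)
      using F(1) K0(2) compactin_imp_closedin[OF Hausdorff_tau]
      by (intro closed_compactin_Inter[of \<tau> K]) blast+
  qed
  have "Int_stable \<K>"
  proof (rule Int_stableI)
    fix C D assume "C \<in> \<K>" "D \<in> \<K>"
    then obtain F G where "F \<subseteq> \<K>0" "finite F" "F \<noteq> {}" "C = \<Inter>F" "G \<subseteq> \<K>0" "finite G" "D = \<Inter>G"
      unfolding \<K>_def by blast
    then show "C \<inter> D \<in> \<K>" unfolding \<K>_def by (intro image_eqI[of _ _ "F \<union> G"]) auto
  qed
  moreover have "sets borel = sigma_sets UNIV \<K>"
  proof
    show "sigma_sets UNIV \<K> \<subseteq> sets borel"
      using compact_borel[OF comp] sets.sigma_sets_subset[of \<K> borel] by auto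
    interpret S: sigma_algebra UNIV "sigma_sets UNIV \<K>"
      by (rule sigma_algebra_sigma_sets) simp
    have "O' \<in> sigma_sets UNIV \<K>" if "open O'" for O'
    proof -
      have "countable {C \<in> \<K>0. C \<subseteq> O'}" by (rule countable_subset[OF _ K0(1)]) auto
      moreover have "{C \<in> \<K>0. C \<subseteq> O'} \<subseteq> sigma_sets UNIV \<K>" using sub by auto
      ultimately have "\<Union>{C \<in> \<K>0. C \<subseteq> O'} \<in> sigma_sets UNIV \<K>"
        by (rule S.countable_Union)
      then show ?thesis using open_eq[OF that] by simp
    qed
    then have "sigma_sets UNIV {S. open S} \<subseteq> sigma_sets UNIV \<K>"
      by (intro sigma_sets_mono) auto
    then show "sets borel \<subseteq> sigma_sets UNIV \<K>" by (simp add: borel_def)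
  qed
  moreover have "\<Union>\<K> = UNIV" using open_eq[of UNIV] sub by blast
  ultimately show ?thesis using that countable comp by blast
qed

lemma borel_eq_sigma_compact: "sets borel = sigma_sets UNIV {C. compactin \<tau> C}"
proof
  obtain \<K> where K: "\<And>C. C \<in> \<K> \<Longrightarrow> compactin \<tau> C" "sets borel = sigma_sets UNIV \<K>"
    using compact_generator by metis
  show "sets borel \<subseteq> sigma_sets UNIV {C. compactin \<tau> C}"
    unfolding K(2) using K(1) by (intro sigma_sets_mono') auto
  show "sigma_sets UNIV {C. compactin \<tau> C} \<subseteq> sets borel"
    using compact_borel sets.sigma_sets_subset[of "{C. compactin \<tau> C}" borel] by auto
qed

section \<open>Invariant measures from finitely additive limits\<close>

text \<open>The measure is the normalised \<open>extension\<close> of \<open>m\<close>. The compact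
  set \<open>K\<close> with \<open>m K > 0\<close> ensures that \<open>mass\<close> is positive, so
  normalising is possible.\<close>

lemma invariant_measure_dominating:
  assumes nonneg: "\<And>A. A \<in> sets borel \<Longrightarrow> 0 \<le> m A"
    and add: "\<And>A B. A \<in> sets borel \<Longrightarrow> B \<in> sets borel \<Longrightarrow> A \<inter> B = {} \<Longrightarrow> m (A \<union> B) = m A + m B"
    and inv: "\<And>A. A \<in> sets borel \<Longrightarrow> m (T -` A) = m A"
    and total: "m UNIV = 1"
    and K: "compactin \<tau> K" "m K > 0"
  obtains M where "invariant_measure T M" "\<And>C. compactin \<tau> C \<Longrightarrow> m C \<le> measure M C"
proof -
  interpret finitely_additive_borel \<tau> m
    by unfold_locales (fact topspace_tau Hausdorff_tau tau_coarser borel_eq_sigma_compact nonneg add)+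
  have cont_image: "cont C \<le> cont (T ` C)" for C
  proof (rule cont_greatest)
    fix U assume U: "openin \<tau> U" "T ` C \<subseteq> U"
    have "openin \<tau> (T -` U)"
      using openin_continuous_map_preimage[OF cont_T_tau U(1)] by (simp add: vimage_def)
    then have "cont C \<le> m (T -` U)" using U(2) by (intro cont_le) auto
    then show "cont C \<le> m U" using inv openin_borel[OF U(1)] by simp
  qed
  \<comment> \<open>If \<open>C\<close> avoids \<open>T -\<close>
    A\<open>, then the compact set\<close>T \<open>C\<close> avoids \<open>A\<close> and has at
    least the content of \<open>C\<close>.\<close>
  have outer_vimage: "outer A \<le> outer (T -` A)" for A
  proof (rule outer_greatest)
    fix C assume C: "compactin \<tau> C" "C \<inter> T -` A = {}"
    have "outer A \<le> ennreal (mass - cont (T ` C))"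
      using C by (intro outer_le image_compactin[OF _ cont_T_tau]) auto
    also have "\<dots> \<le> ennreal (mass - cont C)" using cont_image[of C] by (intro ennreal_leI) simp
    finally show "outer A \<le> ennreal (mass - cont C)" .
  qed
  have pos: "0 < mass" using K m_le_cont[OF compact_borel[OF K(1)]] cont_le_mass[OF K(1)] by linarith
  have le1: "mass \<le> 1" using mass_le total by simp
  have vimage_borel: "T -` A \<in> sets borel" if "A \<in> sets borel" for A
    using measurable_sets[OF T_borel that] by simp
  have total_ext: "emeasure extension UNIV = ennreal mass"
    by (simp add: emeasure_extension outer_UNIV)
  interpret E: finite_measure extension
    by (rule finite_measureI) (simp add: total_ext)
  have le: "measure extension A \<le> measure extension (T -` A)" if "A \<in> sets borel" for A
    using outer_vimage[of A] that vimage_borel[OF that]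
    by (simp add: emeasure_extension[symmetric] E.emeasure_eq_measure)
  \<comment> \<open>The inequality \<open>le\<close> for \<open>A\<close> and for its complement,
    both within the same finite total, forces equality.\<close>
  have eq: "emeasure extension (T -` A) = emeasure extension A" if A: "A \<in> sets borel" for A
  proof -
    have "measure extension (T -` (- A)) = measure extension UNIV - measure extension (T -` A)"
      using E.finite_measure_compl[of "T -` A"] vimage_borel[OF A]
      by (simp add: vimage_Diff Compl_eq_Diff_UNIV)
    moreover have "measure extension (- A) = measure extension UNIV - measure extension A"
      using E.finite_measure_compl[of A] A by (simp add: Compl_eq_Diff_UNIV)
    ultimately show ?thesis
      using le[OF A] le[of "- A"] A by (simp add: E.emeasure_eq_measure)
  qed
  \<comment> \<open>The factor is at least 1 because \<open>mass \<le> 1\<close>, so normalising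
    preserves domination of \<open>m\<close>.\<close>
  define M where "M = scale_measure (ennreal (1 / mass)) extension"
  have sets_M: "sets M = sets borel" by (simp add: M_def)
  have em: "emeasure M A = ennreal (1 / mass) * emeasure extension A" for A
    by (simp add: M_def)
  have "prob_space M"
  proof (rule prob_spaceI)
    have "space M = UNIV" by (simp add: M_def space_scale_measure)
    then show "emeasure M (space M) = 1"
      using pos by (simp add: em total_ext ennreal_mult''[symmetric])
  qed
  then have inv_M: "invariant_measure T M"
    by (simp add: invariant_measure_def borel_prob_def sets_M em eq)
  have "m C \<le> measure M C" if C: "compactin \<tau> C" for C
  proof -
    have "ennreal (m C) \<le> emeasure extension C"
      using m_le_cont[OF compact_borel[OF C]] cont_le_emeasure_extension[OF C]
      by (meson ennreal_leI order_trans)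
    also have "\<dots> \<le> ennreal (1 / mass) * emeasure extension C"
      using mult_right_mono[of 1 "ennreal (1 / mass)" "emeasure extension C"] pos le1 by simp
    also have "\<dots> = ennreal (measure M C)"
      using em finite_measure.emeasure_eq_measure[OF prob_space.finite_measure[OF \<open>prob_space M\<close>]] by metis
    finally show ?thesis by simp
  qed
  with inv_M that show ?thesis by blast
qed

text \<open>The finitely additive limit is taken of the empirical frequencies along the orbit of
  \<open>x\<close>.\<close>

lemma invariant_measure_of_frequent_visits:
  assumes K: "compactin \<tau> K" and x: "lower_density {n. (T ^^ n) x \<in> K} > 0"
  obtains M where "invariant_measure T M" "measure M K > 0"
proof -
  define f where "f N A = real (card ({n. (T ^^ n) x \<in> A} \<inter> {1..N})) / real N" for N A
  have f01: "f N A \<in> {0..1}" for N A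
  proof -
    have "card ({n. (T ^^ n) x \<in> A} \<inter> {1..N}) \<le> card {1..N}" by (intro card_mono) auto
    then show ?thesis by (simp add: f_def divide_le_eq)
  qed
  obtain G m where G: "G \<noteq> bot" "G \<le> sequentially" and m: "\<And>A. ((\<lambda>N. f N A) \<longlongrightarrow> m A) G"
    using cluster_filter_pointwise[of f 0 1, OF f01] by metis
  have ev: "eventually P G" if "eventually P sequentially" for P
    using G(2) that by (rule filter_leD)
  have nonneg: "0 \<le> m A" for A
    using m[of A] by (rule tendsto_lowerbound) (use f01 G in auto)
  have add: "m (A \<union> B) = m A + m B" if "A \<inter> B = {}" for A B
  proof -
    have "card ({n. (T ^^ n) x \<in> A \<union> B} \<inter> {1..N}) =
        card ({n. (T ^^ n) x \<in> A} \<inter> {1..N}) + card ({n. (T ^^ n) x \<in> B} \<inter> {1..N})" for N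
      by (subst card_Un_disjoint[symmetric]) (use that in \<open>auto intro!: arg_cong[of _ _ card]\<close>)
    then have "f N (A \<union> B) = f N A + f N B" for N
      unfolding f_def by (simp add: add_divide_distrib)
    then have "((\<lambda>N. f N (A \<union> B)) \<longlongrightarrow> m A + m B) G"
      using tendsto_add[OF m[of A] m[of B]] by simp
    then show ?thesis using tendsto_unique[OF G(1) m] by blast
  qed
  have total: "m UNIV = 1"
  proof -
    \<comment> \<open>Only from \<open>N = 1\<close> on: for \<open>N = 0\<close> the quotient is
      \<open>0 / 0 = 0\<close>.\<close>
    have "eventually (\<lambda>N. f N UNIV = 1) G"
      by (rule ev, rule eventually_sequentiallyI[of 1]) (simp add: f_def)
    then have "((\<lambda>N. f N UNIV) \<longlongrightarrow> 1) G" by (rule tendsto_eventually)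
    then show ?thesis using tendsto_unique[OF G(1) m] by blast
  qed
  have inv: "m (T -` A) = m A" for A
  proof -
    have diff: "\<bar>f N (T -` A) - f N A\<bar> \<le> 1 / real N" for N
    proof -
      let ?D = "{n. (T ^^ n) x \<in> A}"
      have "?D \<inter> {2..Suc N} = Suc ` ({n. (T ^^ n) x \<in> T -` A} \<inter> {1..N})" (is "?L = ?R")
      proof
        show "?L \<subseteq> ?R"
        proof
          fix n assume "n \<in> ?L"
          then show "n \<in> ?R" by (cases n) auto
        qed
      qed auto
      then have c: "card ({n. (T ^^ n) x \<in> T -` A} \<inter> {1..N}) = card (?D \<inter> {2..Suc N})"
        by (simp only: card_image[OF inj_on_subset[OF inj_Suc subset_UNIV]])
      have "card (?D \<inter> {2..Suc N}) \<le> card (insert (Suc N) (?D \<inter> {1..N}))"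
        by (intro card_mono) auto
      also have "\<dots> \<le> Suc (card (?D \<inter> {1..N}))" by (rule card_insert_le_m1) auto
      finally have 1: "card (?D \<inter> {2..Suc N}) \<le> Suc (card (?D \<inter> {1..N}))" .
      have "card (?D \<inter> {1..N}) \<le> card (insert 1 (?D \<inter> {2..Suc N}))"
        by (intro card_mono) auto
      also have "\<dots> \<le> Suc (card (?D \<inter> {2..Suc N}))" by (rule card_insert_le_m1) auto
      finally have 2: "card (?D \<inter> {1..N}) \<le> Suc (card (?D \<inter> {2..Suc N}))" .
      have "\<bar>real (card (?D \<inter> {2..Suc N})) - real (card (?D \<inter> {1..N}))\<bar> \<le> 1"
        using 1 2 by linarith
      then show ?thesis
        unfolding f_def c by (simp add: diff_divide_distrib[symmetric] divide_right_mono)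
    qed
    have "((\<lambda>N. 1 / real N) \<longlongrightarrow> 0) G"
      by (rule tendsto_mono[OF G(2)]) (rule lim_1_over_n)
    then have "((\<lambda>N. f N (T -` A) - f N A) \<longlongrightarrow> 0) G"
      by (rule Lim_null_comparison[rotated]) (simp add: diff)
    then have "m (T -` A) - m A = 0"
      by (rule tendsto_unique[OF G(1) tendsto_diff[OF m m]])
    then show ?thesis by simp
  qed
  have "m K > 0"
  proof -
    obtain c where c: "c > 0"
      "eventually (\<lambda>N. c \<le> real (card ({n. (T ^^ n) x \<in> K} \<inter> {1..N})) / real N) sequentially"
      using lower_density_posD[OF x] .
    have "c \<le> m K"
      using m[of K] by (rule tendsto_lowerbound) (use ev[OF c(2)] G in \<open>auto simp: f_def\<close>)
    then show ?thesis using c by simp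
  qed
  obtain M where M: "invariant_measure T M" "\<And>C. compactin \<tau> C \<Longrightarrow> m C \<le> measure M C"
    using invariant_measure_dominating[OF nonneg add inv total K \<open>m K > 0\<close>] by blast
  then show ?thesis using that K \<open>m K > 0\<close> by (meson less_le_trans)
qed

section \<open>Maximisers of a convex functional and ergodicity\<close>

text \<open>A maximising sequence has a finitely additive limit \<open>m\<close> on which the
  functional takes the value \<open>S\<close>. A measure dominating \<open>m\<close> on the compact
  sets \<open>C n\<close> can only do better.\<close>

lemma maximiser_exists:
  fixes w :: "nat \<Rightarrow> real" and C :: "nat \<Rightarrow> 'a set"
  defines "\<Phi> \<equiv> \<lambda>M. \<Sum>n. w n * (measure M (C n))\<^sup>2"
  assumes w: "\<And>n. w n > 0" "summable w" and C: "\<And>n. compactin \<tau> (C n)"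
    and M0: "invariant_measure T M0" "measure M0 (C k) > 0"
  obtains M where "invariant_measure T M" "\<And>M'. invariant_measure T M' \<Longrightarrow> \<Phi> M' \<le> \<Phi> M"
proof -
  let ?I = "{M. invariant_measure T M}"
  have prob: "0 \<le> measure M A" "measure M A \<le> 1" if "invariant_measure T M" for M A
    using prob_space.prob_le_1[OF invariant_measureD(3)[OF that]] by auto
  have term_le: "w n * (measure M (C n))\<^sup>2 \<le> w n" if "invariant_measure T M" for M n
    using w(1)[of n] prob[OF that, of "C n"] by (simp add: power_le_one mult_left_le)
  have summ: "summable (\<lambda>n. w n * (measure M (C n))\<^sup>2)" if "invariant_measure T M" for M
    using term_le[OF that] w by (intro summable_comparison_test[OF _ w(2)]) (auto simp: abs_mult less_imp_le)
  have "\<Phi> M \<le> (\<Sum>n. w n)" if "invariant_measure T M" for M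
    unfolding \<Phi>_def using term_le[OF that] summ[OF that] w(2) by (intro suminf_le) auto
  then have bdd: "bdd_above (\<Phi> ` ?I)" by (intro bdd_aboveI[of _ "\<Sum>n. w n"]) auto
  define S where "S = Sup (\<Phi> ` ?I)"
  have le_S: "\<Phi> M \<le> S" if "invariant_measure T M" for M
    unfolding S_def using bdd that by (intro cSUP_upper) auto
  have "\<exists>M. invariant_measure T M \<and> S - 1 / real (Suc n) < \<Phi> M" for n
  proof -
    have "S - 1 / real (Suc n) < Sup (\<Phi> ` ?I)" unfolding S_def by simp
    then show ?thesis using less_cSup_iff[OF _ bdd] M0(1) by auto
  qed
  then obtain \<mu> where \<mu>: "\<And>n. invariant_measure T (\<mu> n)" "\<And>n. S - 1 / real (Suc n) < \<Phi> (\<mu> n)"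
    by metis
  have "(\<lambda>n. \<Phi> (\<mu> n)) \<longlonglongrightarrow> S"
  proof (rule tendsto_sandwich[of "\<lambda>n. S - 1 / real (Suc n)" _ _ "\<lambda>_. S"])
    show "(\<lambda>n. S - 1 / real (Suc n)) \<longlonglongrightarrow> S"
      using tendsto_diff[OF tendsto_const LIMSEQ_inverse_real_of_nat, of S] by (simp add: divide_inverse)
  qed (use le_S[OF \<mu>(1)] less_imp_le[OF \<mu>(2)] in simp_all)
  obtain G m where G: "G \<noteq> bot" "G \<le> sequentially"
    and m: "\<And>A. ((\<lambda>n. measure (\<mu> n) A) \<longlongrightarrow> m A) G"
    using cluster_filter_pointwise[of "\<lambda>n. measure (\<mu> n)" 0 1] prob[OF \<mu>(1)] by auto
  have nonneg: "0 \<le> m A" for A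
    using m[of A] by (rule tendsto_lowerbound) (use G in auto)
  have add: "m (A \<union> B) = m A + m B" if "A \<in> sets borel" "B \<in> sets borel" "A \<inter> B = {}" for A B
  proof -
    have "measure (\<mu> n) (A \<union> B) = measure (\<mu> n) A + measure (\<mu> n) B" for n
      using that invariant_measureD[OF \<mu>(1)[of n]]
      by (intro finite_measure.finite_measure_Union prob_space.finite_measure) auto
    then have "((\<lambda>n. measure (\<mu> n) (A \<union> B)) \<longlongrightarrow> m A + m B) G"
      using tendsto_add[OF m[of A] m[of B]] by simp
    then show ?thesis using tendsto_unique[OF G(1) m] by blast
  qed
  have total: "m UNIV = 1"
  proof -
    have "measure (\<mu> n) UNIV = 1" for n
      using prob_space.prob_space invariant_measureD(2,3)[OF \<mu>(1)[of n]] by metis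
    then show ?thesis using tendsto_unique[OF G(1) m[of UNIV], of 1] by simp
  qed
  have inv: "m (T -` A) = m A" if "A \<in> sets borel" for A
  proof -
    have "measure (\<mu> n) (T -` A) = measure (\<mu> n) A" for n
      using invariant_measureD(6)[OF \<mu>(1)[of n] that] by (simp add: measure_def)
    then show ?thesis using tendsto_unique[OF G(1) m[of "T -` A"]] m[of A] by simp
  qed
  \<comment> \<open>The summable weights dominate the terms, so Tannery's theorem lets the limit
    along \<open>G\<close> pass through the series.\<close>
  have "norm (w i * (measure (\<mu> n) (C i))\<^sup>2) \<le> w i" for i n
    using term_le[OF \<mu>(1), of i n] less_imp_le[OF w(1), of i] by (simp add: abs_mult)
  then have "\<forall>\<^sub>F (i, n) in sequentially \<times>\<^sub>F G. norm (w i * (measure (\<mu> n) (C i))\<^sup>2) \<le> w i"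
    by (intro always_eventually) auto
  then have tannery: "summable (\<lambda>i. norm (w i * (m (C i))\<^sup>2)) \<and>
      ((\<lambda>n. \<Sum>i. w i * (measure (\<mu> n) (C i))\<^sup>2) \<longlongrightarrow> (\<Sum>i. w i * (m (C i))\<^sup>2)) G"
    by (intro conjunct2[OF tannerys_theorem[OF _ _ w(2) G(1)]] tendsto_intros m)
  then have lim_\<Phi>: "((\<lambda>n. \<Phi> (\<mu> n)) \<longlongrightarrow> (\<Sum>i. w i * (m (C i))\<^sup>2)) G"
    and summ_m: "summable (\<lambda>i. norm (w i * (m (C i))\<^sup>2))"
    by (simp_all add: \<Phi>_def)
  have S_eq: "S = (\<Sum>k. w k * (m (C k))\<^sup>2)"
    by (rule tendsto_unique[OF G(1) tendsto_mono[OF G(2) \<open>(\<lambda>n. \<Phi> (\<mu> n)) \<longlonglongrightarrow> S\<close>] lim_\<Phi>])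
  \<comment> \<open>Positivity of \<open>S\<close> rules out that \<open>m\<close> vanishes on every
    \<open>C n\<close>, so a dominating measure exists.\<close>
  have "0 < \<Phi> M0"
    unfolding \<Phi>_def using w(1) M0 summ[OF M0(1)]
    by (intro suminf_pos2[where i = k]) (auto intro!: mult_nonneg_nonneg less_imp_le[OF w(1)])
  then have "0 < S" using le_S[OF M0(1)] by linarith
  have "\<exists>j. m (C j) \<noteq> 0"
  proof (rule ccontr)
    assume "\<not> ?thesis"
    then have "S = 0" by (simp add: S_eq)
    with \<open>0 < S\<close> show False by simp
  qed
  then obtain j where j: "m (C j) \<noteq> 0" by blast
  have mj: "m (C j) > 0" using j nonneg[of "C j"] by linarith
  obtain M where M: "invariant_measure T M" "\<And>K. compactin \<tau> K \<Longrightarrow> m K \<le> measure M K"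
    using invariant_measure_dominating[OF nonneg add inv total C mj] by blast
  have "S \<le> \<Phi> M"
    unfolding S_eq \<Phi>_def
  proof (rule suminf_le)
    show "w n * (m (C n))\<^sup>2 \<le> w n * (measure M (C n))\<^sup>2" for n
      using M(2)[OF C[of n]] nonneg[of "C n"] w(1)[of n] by (intro mult_left_mono power_mono) auto
  qed (rule summable_norm_cancel[OF summ_m], rule summ[OF M(1)])
  then show ?thesis using that[OF M(1)] le_S by (meson order_trans)
qed

text \<open>Conditioning on a strictly invariant set keeps invariance because
  \<open>A \<inter> T -\<close> B = T -\<open>(A \<inter> B)\<close>. Applied to \<open>A\<close>
  and its complement, it decomposes a non-ergodic measure.\<close>

lemma invariant_uniform_measure:
  assumes M: "invariant_measure T M" and A: "A \<in> sets borel" "T -` A = A" "measure M A \<noteq> 0"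
  shows "invariant_measure T (uniform_measure M A)"
    and "\<And>B. B \<in> sets borel \<Longrightarrow> measure (uniform_measure M A) B = measure M (A \<inter> B) / measure M A"
proof -
  note D = invariant_measureD[OF M]
  interpret prob_space M by (rule D)
  have ne: "emeasure M A \<noteq> 0" "emeasure M A \<noteq> \<infinity>"
    using A(3) by (auto simp: emeasure_eq_measure)
  have "prob_space (uniform_measure M A)"
    using ne by (rule prob_space_uniform_measure)
  moreover have "emeasure (uniform_measure M A) (T -` B) = emeasure (uniform_measure M A) B"
    if B: "B \<in> sets borel" for B
  proof -
    have "T -` B \<in> sets borel" using measurable_sets[OF T_borel B] by simp
    moreover have "A \<inter> T -` B = T -` (A \<inter> B)" using A(2) by auto
    ultimately show ?thesis using A(1) B D(1) D(6)[of "A \<inter> B"] by simp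
  qed
  ultimately show "invariant_measure T (uniform_measure M A)"
    by (simp add: invariant_measure_def borel_prob_def D)
  show "measure (uniform_measure M A) B = measure M (A \<inter> B) / measure M A" if "B \<in> sets borel" for B
    using ne that D(1) by (intro measure_uniform_measure) auto
qed

text \<open>A convex combination of two invariant probability measures cannot maximise a strictly convex
  functional unless both agree with it.\<close>

lemma maximiser_ergodic:
  fixes w :: "nat \<Rightarrow> real" and C :: "nat \<Rightarrow> 'a set"
  defines "\<Phi> \<equiv> \<lambda>M. \<Sum>n. w n * (measure M (C n))\<^sup>2"
  assumes w: "\<And>n. w n > 0" "summable w"
    and \<K>: "countable \<K>" "\<K> \<subseteq> range C" "Int_stable \<K>" "sets borel = sigma_sets UNIV \<K>" "\<Union>\<K> = UNIV"
    and C: "\<And>n. C n \<in> sets borel"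
    and M: "invariant_measure T M" and max: "\<And>M'. invariant_measure T M' \<Longrightarrow> \<Phi> M' \<le> \<Phi> M"
  shows "ergodic_measure T M"
  unfolding ergodic_measure_def
proof (intro conjI ballI impI M)
  fix A assume A: "A \<in> sets borel" "T -` A = A"
  note D = invariant_measureD[OF M]
  interpret prob_space M by (rule D)
  show "measure M A = 0 \<or> measure M A = 1"
  proof (rule ccontr)
    assume neg: "\<not> (measure M A = 0 \<or> measure M A = 1)"
    define p where "p = measure M A"
    have p: "p \<noteq> 0" "p \<noteq> 1" "0 < p" "p < 1"
      using neg prob_le_1[of A] measure_nonneg[of M A] unfolding p_def by linarith+
    have Ac: "- A \<in> sets borel" "T -` (- A) = - A" using A by (auto simp: vimage_Compl)
    have pc: "measure M (- A) = 1 - p"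
      using prob_compl[of A] A(1) D by (simp add: p_def Compl_eq_Diff_UNIV)
    define M1 where "M1 = uniform_measure M A"
    define M2 where "M2 = uniform_measure M (- A)"
    have M1: "invariant_measure T M1" "\<And>B. B \<in> sets borel \<Longrightarrow> measure M1 B = measure M (A \<inter> B) / p"
      using invariant_uniform_measure[OF M A] p by (auto simp: M1_def p_def)
    have M2: "invariant_measure T M2" "\<And>B. B \<in> sets borel \<Longrightarrow> measure M2 B = measure M (- A \<inter> B) / (1 - p)"
      using invariant_uniform_measure[OF M Ac] p pc by (auto simp: M2_def)
    have split: "measure M B = p * measure M1 B + (1 - p) * measure M2 B" if B: "B \<in> sets borel" for B
    proof -
      have "measure M ((A \<inter> B) \<union> (- A \<inter> B)) = measure M (A \<inter> B) + measure M (- A \<inter> B)"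
        using A(1) Ac(1) B D(1) by (intro finite_measure_Union) auto
      moreover have "(A \<inter> B) \<union> (- A \<inter> B) = B" by blast
      ultimately show ?thesis using M1(2)[OF B] M2(2)[OF B] p by simp
    qed
    let ?t = "\<lambda>N n. w n * (measure N (C n))\<^sup>2"
    have summ: "summable (?t N)" if "invariant_measure T N" for N
    proof (rule summable_comparison_test[OF _ w(2)], intro exI allI impI)
      fix n
      show "norm (?t N n) \<le> w n"
        using w(1)[of n] prob_space.prob_le_1[OF invariant_measureD(3)[OF that], of "C n"]
        by (simp add: abs_mult power_le_one mult_left_le)
    qed
    \<comment> \<open>The convexity defect of the square:
      \<open>p a^2 + (1-p) b^2 - (p a + (1-p) b)^2 = p (1-p) (a-b)^2\<close>. Maximality makes the
      sum of these nonnegative terms at most zero.\<close>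
    let ?d = "\<lambda>n. w n * p * (1 - p) * (measure M1 (C n) - measure M2 (C n))\<^sup>2"
    have d_eq: "?d n = p * ?t M1 n + (1 - p) * ?t M2 n - ?t M n" for n
      unfolding split[OF C] by (simp add: power2_eq_square algebra_simps)
    have sd: "summable ?d"
      unfolding d_eq by (intro summable_diff summable_add summable_mult summ M M1 M2)
    have "suminf ?d = p * \<Phi> M1 + (1 - p) * \<Phi> M2 - \<Phi> M"
      unfolding d_eq \<Phi>_def
      by (simp add: suminf_diff[symmetric] suminf_add[symmetric] suminf_mult summable_diff summable_add
          summable_mult summ M M1 M2)
    also have "\<dots> \<le> p * \<Phi> M + (1 - p) * \<Phi> M - \<Phi> M"
      using p max[OF M1(1)] max[OF M2(1)] by (intro diff_right_mono add_mono mult_left_mono) auto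
    also have "\<dots> = 0" by (simp add: algebra_simps)
    finally have "suminf ?d \<le> 0" .
    moreover have d_nonneg: "0 \<le> ?d n" for n
      using w(1)[of n] p by (intro mult_nonneg_nonneg) auto
    ultimately have "suminf ?d = 0" using suminf_nonneg[OF sd] by (intro antisym) auto
    then have "?d n = 0" for n using suminf_eq_zero_iff[OF sd d_nonneg] by blast
    from this w(1) have eq: "measure M1 (C n) = measure M2 (C n)" for n
      using p by (simp add: less_imp_neq[symmetric])
    \<comment> \<open>Both agree on the generating pi-system \<open>\<K>\<close>. But
      \<open>M1\<close> gives \<open>A\<close> measure 1 and \<open>M2\<close> gives it 0.\<close>
    have "M1 = M2"
    proof (rule measure_eqI_generator_eq_countable[OF \<K>(3)])
      note fin = prob_space.finite_measure[OF invariant_measureD(3)[OF M1(1)]]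
        prob_space.finite_measure[OF invariant_measureD(3)[OF M2(1)]]
      show "emeasure M1 X = emeasure M2 X" if "X \<in> \<K>" for X
        using that \<K>(2) eq by (auto simp: fin[THEN finite_measure.emeasure_eq_measure])
      show "emeasure M1 X \<noteq> \<infinity>" for X
        by (simp add: fin[THEN finite_measure.emeasure_eq_measure])
    qed (use \<K> invariant_measureD(1)[OF M1(1)] invariant_measureD(1)[OF M2(1)] in auto)
    then show False using M1(2)[OF A(1)] M2(2)[OF A(1)] p by (simp add: p_def)
  qed
qed

text \<open>Giving \<open>K\<close> weight \<open>1\<close> and all other compact sets together weight \<open>s\<^sup>2 / 2\<close>, where
  \<open>s = M0 K\<close>, forces every maximiser to charge \<open>K\<close>.\<close>

lemma ergodic_measure_charging_compact:
  assumes M0: "invariant_measure T M0" and K: "compactin \<tau> K" and pos: "measure M0 K > 0"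
  obtains M where "ergodic_measure T M" "measure M K > 0"
proof -
  obtain \<K> where \<K>: "countable \<K>" "\<And>C. C \<in> \<K> \<Longrightarrow> compactin \<tau> C" "Int_stable \<K>"
    "sets borel = sigma_sets UNIV \<K>" "\<Union>\<K> = UNIV"
    using compact_generator by metis
  have "\<K> \<noteq> {}" using \<K>(5) by auto
  define s where "s = measure M0 K"
  define C where "C = case_nat K (from_nat_into \<K>)"
  define w :: "nat \<Rightarrow> real" where "w = case_nat 1 (\<lambda>n. s\<^sup>2 / 2 * (1/2) ^ Suc n)"
  have s: "s > 0" using pos by (simp add: s_def)
  have C_simps: "C 0 = K" "C (Suc n) = from_nat_into \<K> n" for n by (simp_all add: C_def)
  have w_simps: "w 0 = 1" "w (Suc n) = s\<^sup>2 / 2 * (1/2) ^ Suc n" for n by (simp_all add: w_def)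
  have C: "compactin \<tau> (C n)" for n
    by (cases n) (simp_all add: C_simps K \<K>(2) from_nat_into[OF \<open>\<K> \<noteq> {}\<close>])
  have w_tail: "(\<lambda>n. w (Suc n)) sums (s\<^sup>2 / 2)"
    unfolding w_simps using sums_mult[OF power_half_series, of "s\<^sup>2 / 2"] by simp
  have w: "w n > 0" "summable w" for n
    using s summable_Suc_iff[of w] sums_summable[OF w_tail]
    by (cases n; simp add: w_simps del: power_Suc)+
  let ?\<Phi> = "\<lambda>M. \<Sum>n. w n * (measure M (C n))\<^sup>2"
  have posC: "measure M0 (C 0) > 0" using pos by (simp add: C_simps)
  obtain M where M: "invariant_measure T M" "\<And>M'. invariant_measure T M' \<Longrightarrow> ?\<Phi> M' \<le> ?\<Phi> M"
    using maximiser_exists[of w C M0 0, OF w C M0 posC] by blast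
  have "\<K> \<subseteq> range C"
  proof
    fix X assume "X \<in> \<K>"
    then obtain n where "from_nat_into \<K> n = X" using from_nat_into_surj[OF \<K>(1)] by blast
    then show "X \<in> range C" using C_simps(2)[of n] by blast
  qed
  then have "ergodic_measure T M"
    using maximiser_ergodic[of w \<K> C M, OF w \<K>(1) _ \<K>(3-5) compact_borel[OF C] M] by blast
  moreover have "measure M K > 0"
  proof -
    have summ: "summable (\<lambda>n. w n * (measure N (C n))\<^sup>2)" and
      le: "w n * (measure N (C n))\<^sup>2 \<le> w n" if "invariant_measure T N" for N n
    proof -
      show le: "w n * (measure N (C n))\<^sup>2 \<le> w n" for n
        using w(1)[of n] prob_space.prob_le_1[OF invariant_measureD(3)[OF that], of "C n"]
        by (simp add: power_le_one mult_left_le)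
      show "summable (\<lambda>n. w n * (measure N (C n))\<^sup>2)"
        by (rule summable_comparison_test[OF _ w(2)])
          (use le less_imp_le[OF w(1)] in \<open>simp add: abs_mult\<close>)
    qed
    \<comment> \<open>The term of index 0 alone gives \<open>M0\<close> at least \<open>s^2\<close>.
      The tail is at most \<open>s^2 / 2\<close> for any invariant measure, so the term of
      \<open>K\<close> must make up the rest for \<open>M\<close>.\<close>
    have "s\<^sup>2 \<le> ?\<Phi> M0"
      using sum_le_suminf[OF summ[OF M0], of "{0}"] w(1)
      by (auto simp: C_simps w_simps s_def less_imp_le)
    also have "\<dots> \<le> ?\<Phi> M" by (rule M(2)[OF M0])
    also have "\<dots> = (measure M K)\<^sup>2 + (\<Sum>n. w (Suc n) * (measure M (C (Suc n)))\<^sup>2)"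
      using suminf_split_head[OF summ[OF M(1)]] by (simp add: C_simps(1) w_simps(1))
    also have "(\<Sum>n. w (Suc n) * (measure M (C (Suc n)))\<^sup>2) \<le> (\<Sum>n. w (Suc n))"
      using summ[OF M(1)] w(2) summable_Suc_iff[of w]
        summable_Suc_iff[of "\<lambda>n. w n * (measure M (C n))\<^sup>2"]
      by (intro suminf_le le[OF M(1)]) auto
    also have "\<dots> = s\<^sup>2 / 2" using w_tail by (rule sums_unique[symmetric])
    finally have "s\<^sup>2 / 2 \<le> (measure M K)\<^sup>2" by simp
    moreover have "0 < s\<^sup>2 / 2" using s by simp
    ultimately have "measure M K \<noteq> 0" by auto
    then show ?thesis using measure_nonneg[of M K] by linarith
  qed
  ultimately show ?thesis using that by blast
qed

section \<open>Mixing local measures into one of full support\<close>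

text \<open>One measure is chosen for each nonempty basic open set, and these countably many
  measures are averaged with positive weights.\<close>

lemma full_support_of_local:
  assumes loc: "\<And>V. open V \<Longrightarrow> V \<noteq> {} \<Longrightarrow> \<exists>M. invariant_measure T M \<and> emeasure M V > 0"
  obtains M where "invariant_measure T M" "full_support M"
proof -
  obtain B :: "'a set set" where B: "countable B" "topological_basis B"
    using ex_countable_basis by blast
  define B' where "B' = B - {{}}"
  have "countable B'" using B(1) by (simp add: B'_def)
  have B'_sub: "\<exists>W\<in>B'. W \<subseteq> V" if "open V" "V \<noteq> {}" for V
  proof -
    obtain x where "x \<in> V" using \<open>V \<noteq> {}\<close> by blast
    then obtain W where "W \<in> B" "x \<in> W" "W \<subseteq> V"
      using topological_basisE[OF B(2) \<open>open V\<close>] by metis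
    then show ?thesis by (auto simp: B'_def)
  qed
  then have "B' \<noteq> {}" using open_UNIV by blast
  define b where "b = from_nat_into B'"
  have b: "open (b n)" "b n \<noteq> {}" for n
    using from_nat_into[OF \<open>B' \<noteq> {}\<close>, of n] topological_basis_open[OF B(2)]
    by (auto simp: b_def B'_def)
  then have "\<exists>M. invariant_measure T M \<and> emeasure M (b n) > 0" for n by (intro loc)
  then obtain N where N: "\<And>n. invariant_measure T (N n)" "\<And>n. emeasure (N n) (b n) > 0" by metis
  \<comment> \<open>The geometric distribution gives every \<open>n\<close> positive weight, so a
    single \<open>N n\<close> charging \<open>V\<close> makes the mixture charge it.\<close>
  let ?p = "measure_pmf (geometric_pmf (1/2))"
  have meas: "N \<in> measurable ?p (subprob_algebra borel)"
    using invariant_measureD(1,3)[OF N(1)] prob_space_imp_subprob_space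
    by (auto simp: space_subprob_algebra)
  define M where "M = ?p \<bind> N"
  have sets_M: "sets M = sets borel"
    unfolding M_def using invariant_measureD(1)[OF N(1)] by (intro sets_bind) auto
  have em: "emeasure M A = (\<integral>\<^sup>+n. emeasure (N n) A \<partial>?p)" if "A \<in> sets borel" for A
    unfolding M_def using meas that by (intro emeasure_bind) auto
  have "prob_space M"
    unfolding M_def using meas invariant_measureD(3)[OF N(1)]
    by (intro measure_pmf.prob_space_bind) auto
  moreover have "emeasure M (T -` A) = emeasure M A" if "A \<in> sets borel" for A
    using that measurable_sets[OF T_borel that] invariant_measureD(6)[OF N(1) that]
    by (simp add: em)
  ultimately have "invariant_measure T M"
    by (simp add: invariant_measure_def borel_prob_def sets_M)
  moreover have "full_support M"
    unfolding full_support_def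
  proof (intro allI impI)
    fix V :: "'a set" assume V: "open V \<and> V \<noteq> {}"
    then obtain W where "W \<in> B'" "W \<subseteq> V" using B'_sub by blast
    then obtain n where n: "b n \<subseteq> V" using from_nat_into_surj[OF \<open>countable B'\<close>] unfolding b_def by metis
    have "0 < emeasure (N n) (b n)" by (rule N(2))
    also have "\<dots> \<le> emeasure (N n) V"
      using n V invariant_measureD(1)[OF N(1)] by (intro emeasure_mono) auto
    finally have "\<not> (AE n in ?p. emeasure (N n) V = 0)"
      by (auto simp: AE_measure_pmf_iff set_pmf_geometric intro!: exI[of _ n])
    then have "emeasure M V \<noteq> 0"
      using V by (simp add: em nn_integral_0_iff_AE)
    then show "0 < emeasure M V" by (simp add: zero_less_iff_neq_zero)
  qed
  ultimately show ?thesis using that by blast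
qed

end

section \<open>The cycle of implications between full support, ergodic measures and frequent
  recurrence\<close>

theorem proposition2:
  fixes T :: "'a::polish_space \<Rightarrow> 'a" and \<tau> :: "'a topology"
  assumes "continuous_on UNIV T"
    and "topspace \<tau> = UNIV"
    and "Hausdorff_space \<tau>"
    and "\<And>U. openin \<tau> U \<Longrightarrow> open U"
    and "\<And>x U. open U \<Longrightarrow> x \<in> U \<Longrightarrow>
           \<exists>K. compactin \<tau> K \<and> x \<in> interior K \<and> K \<subseteq> U"
    and "continuous_map \<tau> \<tau> T"
  shows "((\<exists>M. invariant_measure T M \<and> full_support M) \<longleftrightarrow>
          (\<forall>V. open V \<and> V \<noteq> {} \<longrightarrow> (\<exists>M. ergodic_measure T M \<and> emeasure M V > 0)))
       \<and> ((\<forall>V. open V \<and> V \<noteq> {} \<longrightarrow> (\<exists>M. ergodic_measure T M \<and> emeasure M V > 0)) \<longleftrightarrow>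
          frequently_recurrent T)"
proof -
  interpret compactly_based_system T \<tau>
    by unfold_locales (fact assms)+
  have compact_inside: "\<exists>K. compactin \<tau> K \<and> interior K \<noteq> {} \<and> K \<subseteq> V" if "open V" "V \<noteq> {}" for V
    using that assms(5) by blast
  have mono: "emeasure M V > 0"
    if "invariant_measure T M" "measure M K > 0" "K \<subseteq> V" "open V" for M K V
  proof -
    have "0 < emeasure M K" using that(2) by (auto simp: measure_def enn2real_positive_iff)
    also have "\<dots> \<le> emeasure M V"
      using that invariant_measureD(1)[OF that(1)] by (intro emeasure_mono) auto
    finally show ?thesis .
  qed
  have "\<exists>M. ergodic_measure T M \<and> emeasure M V > 0"
    if M0: "invariant_measure T M0" "full_support M0" and V: "open V" "V \<noteq> {}" for M0 V
  proof -
    obtain K where K: "compactin \<tau> K" "interior K \<noteq> {}" "K \<subseteq> V" using compact_inside[OF V] by blast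
    note D = invariant_measureD[OF M0(1)]
    interpret M0: prob_space M0 by (rule D)
    have "0 < emeasure M0 (interior K)" using M0(2) K(2) by (simp add: full_support_def)
    also have "\<dots> \<le> emeasure M0 K"
      using compact_borel[OF K(1)] D(1) interior_subset by (intro emeasure_mono) auto
    finally have "measure M0 K > 0" by (simp add: M0.emeasure_eq_measure)
    then obtain M where M: "ergodic_measure T M" "measure M K > 0"
      using ergodic_measure_charging_compact[OF M0(1) K(1)] by blast
    then show ?thesis using mono[of M K V] K V by (auto simp: ergodic_measure_def)
  qed
  moreover have "frequently_recurrent T"
    if erg: "\<forall>V. open V \<and> V \<noteq> {} \<longrightarrow> (\<exists>M. ergodic_measure T M \<and> emeasure M V > 0)"
    unfolding frequently_recurrent_def
  proof (intro allI impI)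
    fix V :: "'a set" assume V: "open V \<and> V \<noteq> {}"
    then obtain M where "ergodic_measure T M" "emeasure M V > 0" using erg by blast
    then show "\<exists>x\<in>V. lower_density {n. (T ^^ n) x \<in> V} > 0"
      using V by (intro exists_frequently_recurrent_point[of T M V]) (auto simp: ergodic_measure_def)
  qed
  moreover have "\<exists>M. invariant_measure T M \<and> full_support M" if fr: "frequently_recurrent T"
  proof -
    have "\<exists>M. invariant_measure T M \<and> emeasure M V > 0" if V: "open V" "V \<noteq> {}" for V
    proof -
      obtain K where K: "compactin \<tau> K" "interior K \<noteq> {}" "K \<subseteq> V" using compact_inside[OF V] by blast
      \<comment> \<open>Recurrence is applied to \<open>interior K\<close> instead of
        \<open>V\<close>, so that the visits are to a compact set, as the limit construction
        requires.\<close>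
      obtain x where "lower_density {n. (T ^^ n) x \<in> interior K} > 0"
        using fr K(2) unfolding frequently_recurrent_def by (meson open_interior)
      also have "\<dots> \<le> lower_density {n. (T ^^ n) x \<in> K}"
        using interior_subset[of K] by (intro lower_density_mono) auto
      finally obtain M where "invariant_measure T M" "measure M K > 0"
        by (rule invariant_measure_of_frequent_visits[OF K(1)])
      then show ?thesis using mono K V by blast
    qed
    then show ?thesis using full_support_of_local by blast
  qed
  ultimately show ?thesis by blast
qed
end
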